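(* If the cyclotomic Brauer category $\mathcal{CB}(p,\mathbb O)$ is not the zero category, then it is isomorphic to $\mathcal{CB}(m):=\mathcal{CB}(m,\mathbb O_m)$ for $m=m_{L(p,\mathbb O)}$.
   Context: $\Bbbk$ is a field of characteristic different from $2$. The affine Brauer category $\mathcal{AB}$ is the strict $\Bbbk$-linear monoidal category (unit object $\mathbf 1$) generated by one object $B$ and morphisms $\mathrm{cap}\colon B\otimes B\to\mathbf 1$, $\mathrm{cup}\colon\mathbf 1\to B\otimes B$, $s\colon B\otimes B\to B\otimes B$, $x\colon B\to B$ (the dot), subject to the relations (with $I=1_B$): $s\circ s=1_{B\otimes B}$; $(s\otimes I)(I\otimes s)(s\otimes I)=(I\otimes s)(s\otimes I)(I\otimes s)$; $(I\otimes \mathrm{cap})(\mathrm{cup}\otimes I)=I=(\mathrm{cap}\otimes I)(I\otimes\mathrm{cup})$; $\mathrm{cap}\circ s=\mathrm{cap}$; $(I\otimes\mathrm{cap})(s\otimes I)=(\mathrm{cap}\otimes I)(I\otimes s)$; $(x\otimes I)s-s(I\otimes x)=1_{B\otimes B}-\mathrm{cup}\circ\mathrm{cap}$; $\mathrm{cap}(x\otimes I)=-\mathrm{cap}(I\otimes x)$. Define $\beta_r(u)=1_{\mathbf 1}+\frac{2u}{2u-1}\sum_{n\ge0}\left(\mathrm{cap}\circ(I\otimes x^n)\circ\mathrm{cup}\right)u^{-n-1}\in\mathrm{End}(\mathbf 1)[[u^{-1}]]$, expanded in powers of $u^{-1}$. Let $p\in\Bbbk[u]$ be monic and let $\mathbb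 O(u)=\sum_{r\ge-1}\mathbb O^{(r)}u^{-r-1}\in1+u^{-1}\Bbbk[[u^{-1}]]$ satisfy $\mathbb O(u)\mathbb O(-u)=1$. A left tensor ideal of $\mathcal{AB}$ is a family of subspaces of the morphism spaces closed under composition on both sides with arbitrary morphisms and under $f\mapsto1_X\otimes f$ for all objects $X$. Let $\mathcal I(p,\mathbb O)$ be the left tensor ideal generated by $p(x)$ and by $[\beta_r(u)]_{u^{-r-1}}-\mathbb O^{(r)}1_{\mathbf 1}$, $r\in\mathbb N=\{0,1,2,\dots\}$, where $[\ ]_{u^k}$ denotes the coefficient of $u^k$. The cyclotomic Brauer category is the quotient $\mathcal{CB}(p,\mathbb O)=\mathcal{AB}/\mathcal I(p,\mathbb O)$, a left module category over $\mathcal{AB}$. Let $L(p,\mathbb O)$ be the image of $\mathbf 1$ in it; $m_{L(p,\mathbb O)}$ is the monic minimal polynomial of the dot $x$ in the algebra $\mathrm{End}_{\mathcal{CB}(p,\mathbb O)}(B)$ (i.e. the monic generator of the kernel of $\Bbbk[u]\to\mathrm{End}_{\mathcal{CB}(p,\mathbb O)}(B)$, $u\mapsto x$). For nonzero $f\in\Bbbk[u]$, $\mathbb O_f(u):=\frac{\left((-1)^{\deg f}u-\frac12\right)f(-u)}{(u-\frac12)f(u)}\in1+u^{-1}\Bbbk[[u^{-1}]]$. *)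

theory Defs
  imports "HOL-Computational_Algebra.Computational_Algebra"
begin

section \<open>Linear categories, strict monoidal categories and module categories\<close>

text \<open>
  Objects are all elements of a type. Morphism spaces of different (source, target) pairs are
  understood to be disjoint, so that the operations on morphisms need not mention objects.
  \<open>cmp C g f\<close> is the composite "g after f".
\<close>

record ('o, 'm, 'k) linear_category =
  hom :: "'o \<Rightarrow> 'o \<Rightarrow> 'm set"
  idm :: "'o \<Rightarrow> 'm"
  cmp :: "'m \<Rightarrow> 'm \<Rightarrow> 'm"
  zer :: "'o \<Rightarrow> 'o \<Rightarrow> 'm"
  add :: "'m \<Rightarrow> 'm \<Rightarrow> 'm"
  scl :: "'k \<Rightarrow> 'm \<Rightarrow> 'm"

record ('o, 'm, 'k) monoidal_category = "('o, 'm, 'k) linear_category" +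
  unit_ob :: 'o
  tens_ob :: "'o \<Rightarrow> 'o \<Rightarrow> 'o"
  tens :: "'m \<Rightarrow> 'm \<Rightarrow> 'm"

text \<open>A left module category over a monoidal category with objects \<open>'x\<close> and morphisms \<open>'a\<close>.\<close>

record ('x, 'a, 'o, 'm, 'k) module_category = "('o, 'm, 'k) linear_category" +
  act_ob :: "'x \<Rightarrow> 'o \<Rightarrow> 'o"
  act :: "'a \<Rightarrow> 'm \<Rightarrow> 'm"

definition sub :: "('o, 'm, 'k::field, 'z) linear_category_scheme \<Rightarrow> 'm \<Rightarrow> 'm \<Rightarrow> 'm" where
  "sub C f g = add C f (scl C (-1) g)"

primrec lsum ::
  "('o, 'm, 'k, 'z) linear_category_scheme \<Rightarrow> 'o \<Rightarrow> 'o \<Rightarrow> (nat \<Rightarrow> 'm) \<Rightarrow> nat \<Rightarrow> 'm" where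
  "lsum C a b f 0 = zer C a b"
| "lsum C a b f (Suc n) = add C (lsum C a b f n) (f n)"

primrec epow :: "('o, 'm, 'k, 'z) linear_category_scheme \<Rightarrow> 'o \<Rightarrow> 'm \<Rightarrow> nat \<Rightarrow> 'm" where
  "epow C a f 0 = idm C a"
| "epow C a f (Suc n) = cmp C f (epow C a f n)"

text \<open>The value \<open>p(f)\<close> of a polynomial at an endomorphism \<open>f\<close> of the object \<open>a\<close>.\<close>

definition end_poly ::
  "('o, 'm, 'k::field, 'z) linear_category_scheme \<Rightarrow> 'o \<Rightarrow> 'm \<Rightarrow> 'k poly \<Rightarrow> 'm" where
  "end_poly C a f p = lsum C a a (\<lambda>i. scl C (coeff p i) (epow C a f i)) (Suc (degree p))"

text \<open>The monic generator of the kernel of \<open>p \<mapsto> p(f)\<close> (arbitrary if this kernel is zero).\<close>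

definition end_min_poly ::
  "('o, 'm, 'k::field, 'z) linear_category_scheme \<Rightarrow> 'o \<Rightarrow> 'm \<Rightarrow> 'k poly" where
  "end_min_poly C a f =
    (THE m. lead_coeff m = 1 \<and> {q. end_poly C a f q = zer C a a} = {q. m dvd q})"

definition zero_category :: "('o, 'm, 'k, 'z) linear_category_scheme \<Rightarrow> bool" where
  "zero_category C \<longleftrightarrow> (\<forall>a b. hom C a b = {zer C a b})"

definition left_tensor_ideal ::
  "('o, 'm, 'k, 'z) monoidal_category_scheme \<Rightarrow> ('o \<Rightarrow> 'o \<Rightarrow> 'm set) \<Rightarrow> bool" where
  "left_tensor_ideal C I \<longleftrightarrow>
    (\<forall>a b. I a b \<subseteq> hom C a b \<and> zer C a b \<in> I a b
      \<and> (\<forall>f \<in> I a b. \<forall>g \<in> I a b. add C f g \<in> I a b)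
      \<and> (\<forall>c. \<forall>f \<in> I a b. scl C c f \<in> I a b)) \<and>
    (\<forall>a b c. \<forall>f \<in> I a b. \<forall>g \<in> hom C b c. cmp C g f \<in> I a c) \<and>
    (\<forall>a b c. \<forall>f \<in> hom C a b. \<forall>g \<in> I b c. cmp C g f \<in> I a c) \<and>
    (\<forall>x a b. \<forall>f \<in> I a b. tens C (idm C x) f \<in> I (tens_ob C x a) (tens_ob C x b))"

definition generated_left_tensor_ideal ::
  "('o, 'm, 'k, 'z) monoidal_category_scheme \<Rightarrow> ('o \<Rightarrow> 'o \<Rightarrow> 'm set) \<Rightarrow> 'o \<Rightarrow> 'o \<Rightarrow> 'm set" where
  "generated_left_tensor_ideal C G a b =
    \<Inter> {I a b | I. left_tensor_ideal C I \<and> (\<forall>a b. G a b \<subseteq> I a b)}"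

definition coset ::
  "('o, 'm, 'k::field, 'z) linear_category_scheme \<Rightarrow> ('o \<Rightarrow> 'o \<Rightarrow> 'm set) \<Rightarrow> 'm \<Rightarrow> 'm set" where
  "coset C I f = {g. \<exists>a b. f \<in> hom C a b \<and> g \<in> hom C a b \<and> sub C g f \<in> I a b}"

text \<open>
  The quotient \<open>C/I\<close> by a left tensor ideal, as a left module category over \<open>C\<close>. Its morphisms are
  the cosets \<open>f + I a b\<close>. Each operation on cosets is the union of the cosets of the values on
  representatives; these all coincide when \<open>I\<close> is a left tensor ideal.
\<close>

definition quotient_category ::
  "('o, 'm, 'k::field, 'z) monoidal_category_scheme \<Rightarrow> ('o \<Rightarrow> 'o \<Rightarrow> 'm set)
    \<Rightarrow> ('o, 'm, 'o, 'm set, 'k) module_category" where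
  "quotient_category C I =
    \<lparr> hom = (\<lambda>a b. coset C I ` hom C a b),
      idm = (\<lambda>a. coset C I (idm C a)),
      cmp = (\<lambda>G F. \<Union>g \<in> G. \<Union>f \<in> F. coset C I (cmp C g f)),
      zer = (\<lambda>a b. coset C I (zer C a b)),
      add = (\<lambda>F G. \<Union>f \<in> F. \<Union>g \<in> G. coset C I (add C f g)),
      scl = (\<lambda>c F. \<Union>f \<in> F. coset C I (scl C c f)),
      act_ob = tens_ob C,
      act = (\<lambda>h F. \<Union>f \<in> F. coset C I (tens C h f)) \<rparr>"

text \<open>
  Isomorphism of left module categories over \<open>A\<close>: a linear functor that is bijective on objects and
  on morphism spaces and commutes strictly with the action of \<open>A\<close>.
\<close>

definition module_category_iso ::
  "('x, 'a, 'k, 'w) monoidal_category_scheme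
    \<Rightarrow> ('x, 'a, 'o, 'm, 'k, 'y) module_category_scheme
    \<Rightarrow> ('x, 'a, 'p, 'n, 'k, 'z) module_category_scheme
    \<Rightarrow> ('o \<Rightarrow> 'p) \<Rightarrow> ('m \<Rightarrow> 'n) \<Rightarrow> bool" where
  "module_category_iso A M N \<phi> \<Phi> \<longleftrightarrow>
    bij \<phi> \<and>
    (\<forall>a b. bij_betw \<Phi> (hom M a b) (hom N (\<phi> a) (\<phi> b))) \<and>
    (\<forall>a. \<Phi> (idm M a) = idm N (\<phi> a)) \<and>
    (\<forall>a b c. \<forall>f \<in> hom M a b. \<forall>g \<in> hom M b c. \<Phi> (cmp M g f) = cmp N (\<Phi> g) (\<Phi> f)) \<and>
    (\<forall>a b. \<forall>f \<in> hom M a b. \<forall>g \<in> hom M a b. \<Phi> (add M f g) = add N (\<Phi> f) (\<Phi> g)) \<and>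
    (\<forall>a b c. \<forall>f \<in> hom M a b. \<Phi> (scl M c f) = scl N c (\<Phi> f)) \<and>
    (\<forall>x a. \<phi> (act_ob M x a) = act_ob N x (\<phi> a)) \<and>
    (\<forall>x y a b. \<forall>h \<in> hom A x y. \<forall>f \<in> hom M a b. \<Phi> (act M h f) = act N h (\<Phi> f))"

definition isomorphic_module_categories ::
  "('x, 'a, 'k, 'w) monoidal_category_scheme
    \<Rightarrow> ('x, 'a, 'o, 'm, 'k, 'y) module_category_scheme
    \<Rightarrow> ('x, 'a, 'p, 'n, 'k, 'z) module_category_scheme \<Rightarrow> bool" where
  "isomorphic_module_categories A M N \<longleftrightarrow> (\<exists>\<phi> \<Phi>. module_category_iso A M N \<phi> \<Phi>)"


section \<open>The affine Brauer category\<close>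

text \<open>
  Generators and relations: the objects are the tensor powers of \<open>B\<close>, encoded by their exponent, and
  morphisms are well-typed formal expressions in the generators modulo the smallest congruence
  containing the axioms of a strict linear monoidal category and the defining relations.
\<close>

datatype 'k ab_term =
    Idm nat | Cap | Cup | Swap | Dot
  | Zer nat nat
  | Add "'k ab_term" "'k ab_term"  (infixl "\<^bold>+" 65)
  | Scl 'k "'k ab_term"  (infixr "\<^bold>*" 75)
  | Cmp "'k ab_term" "'k ab_term"  (infixl "\<^bold>\<cdot>" 70)
  | Tens "'k ab_term" "'k ab_term"  (infixl "\<^bold>\<otimes>" 72)

text \<open>\<open>typed t a b\<close> says that \<open>t\<close> is an expression for a morphism from \<open>B\<close>-power \<open>a\<close> to
  \<open>B\<close>-power \<open>b\<close>.\<close>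

inductive typed :: "'k ab_term \<Rightarrow> nat \<Rightarrow> nat \<Rightarrow> bool" where
  "typed (Idm n) n n"
| "typed Cap 2 0"
| "typed Cup 0 2"
| "typed Swap 2 2"
| "typed Dot 1 1"
| "typed (Zer a b) a b"
| "typed s a b \<Longrightarrow> typed t a b \<Longrightarrow> typed (s \<^bold>+ t) a b"
| "typed t a b \<Longrightarrow> typed (c \<^bold>* t) a b"
| "typed t b c \<Longrightarrow> typed s a b \<Longrightarrow> typed (t \<^bold>\<cdot> s) a c"
| "typed s a b \<Longrightarrow> typed t c d \<Longrightarrow> typed (s \<^bold>\<otimes> t) (a + c) (b + d)"

abbreviation (input) one_strand :: "'k ab_term"  ("\<^bold>I") where
  "\<^bold>I \<equiv> Idm 1"

text \<open>The defining relations of the affine Brauer category.\<close>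

inductive ab_relation :: "'k::field ab_term \<Rightarrow> 'k ab_term \<Rightarrow> bool" where
  "ab_relation (Swap \<^bold>\<cdot> Swap) (Idm 2)"
| "ab_relation ((Swap \<^bold>\<otimes> \<^bold>I) \<^bold>\<cdot> (\<^bold>I \<^bold>\<otimes> Swap) \<^bold>\<cdot> (Swap \<^bold>\<otimes> \<^bold>I))
    ((\<^bold>I \<^bold>\<otimes> Swap) \<^bold>\<cdot> (Swap \<^bold>\<otimes> \<^bold>I) \<^bold>\<cdot> (\<^bold>I \<^bold>\<otimes> Swap))"
| "ab_relation ((\<^bold>I \<^bold>\<otimes> Cap) \<^bold>\<cdot> (Cup \<^bold>\<otimes> \<^bold>I)) \<^bold>I"
| "ab_relation \<^bold>I ((Cap \<^bold>\<otimes> \<^bold>I) \<^bold>\<cdot> (\<^bold>I \<^bold>\<otimes> Cup))"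
| "ab_relation (Cap \<^bold>\<cdot> Swap) Cap"
| "ab_relation ((\<^bold>I \<^bold>\<otimes> Cap) \<^bold>\<cdot> (Swap \<^bold>\<otimes> \<^bold>I)) ((Cap \<^bold>\<otimes> \<^bold>I) \<^bold>\<cdot> (\<^bold>I \<^bold>\<otimes> Swap))"
| "ab_relation ((Dot \<^bold>\<otimes> \<^bold>I) \<^bold>\<cdot> Swap \<^bold>+ (-1) \<^bold>* (Swap \<^bold>\<cdot> (\<^bold>I \<^bold>\<otimes> Dot)))
    (Idm 2 \<^bold>+ (-1) \<^bold>* (Cup \<^bold>\<cdot> Cap))"
| "ab_relation (Cap \<^bold>\<cdot> (Dot \<^bold>\<otimes> \<^bold>I)) ((-1) \<^bold>* (Cap \<^bold>\<cdot> (\<^bold>I \<^bold>\<otimes> Dot)))"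

text \<open>\<open>ab_eq a b s t\<close>: the expressions \<open>s\<close> and \<open>t\<close> denote the same morphism from \<open>a\<close> to \<open>b\<close>.\<close>

inductive ab_eq :: "nat \<Rightarrow> nat \<Rightarrow> 'k::field ab_term \<Rightarrow> 'k ab_term \<Rightarrow> bool" where
  refl: "typed t a b \<Longrightarrow> ab_eq a b t t"
| sym: "ab_eq a b s t \<Longrightarrow> ab_eq a b t s"
| trans: "ab_eq a b s t \<Longrightarrow> ab_eq a b t u \<Longrightarrow> ab_eq a b s u"
\<comment> \<open>compatibility with the operations\<close>
| add_cong: "ab_eq a b s s' \<Longrightarrow> ab_eq a b t t' \<Longrightarrow> ab_eq a b (s \<^bold>+ t) (s' \<^bold>+ t')"
| scl_cong: "ab_eq a b t t' \<Longrightarrow> ab_eq a b (c \<^bold>* t) (c \<^bold>* t')"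
| cmp_cong: "ab_eq b c t t' \<Longrightarrow> ab_eq a b s s' \<Longrightarrow> ab_eq a c (t \<^bold>\<cdot> s) (t' \<^bold>\<cdot> s')"
| tens_cong: "ab_eq a b s s' \<Longrightarrow> ab_eq c d t t'
    \<Longrightarrow> ab_eq (a + c) (b + d) (s \<^bold>\<otimes> t) (s' \<^bold>\<otimes> t')"
\<comment> \<open>morphism spaces are vector spaces\<close>
| add_assoc: "typed s a b \<Longrightarrow> typed t a b \<Longrightarrow> typed u a b
    \<Longrightarrow> ab_eq a b (s \<^bold>+ t \<^bold>+ u) (s \<^bold>+ (t \<^bold>+ u))"
| add_commute: "typed s a b \<Longrightarrow> typed t a b \<Longrightarrow> ab_eq a b (s \<^bold>+ t) (t \<^bold>+ s)"
| add_zero: "typed t a b \<Longrightarrow> ab_eq a b (t \<^bold>+ Zer a b) t"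
| add_neg: "typed t a b \<Longrightarrow> ab_eq a b (t \<^bold>+ (-1) \<^bold>* t) (Zer a b)"
| scl_one: "typed t a b \<Longrightarrow> ab_eq a b (1 \<^bold>* t) t"
| scl_scl: "typed t a b \<Longrightarrow> ab_eq a b (c \<^bold>* d \<^bold>* t) ((c * d) \<^bold>* t)"
| scl_add: "typed s a b \<Longrightarrow> typed t a b \<Longrightarrow> ab_eq a b (c \<^bold>* (s \<^bold>+ t)) (c \<^bold>* s \<^bold>+ c \<^bold>* t)"
| add_scl: "typed t a b \<Longrightarrow> ab_eq a b ((c + d) \<^bold>* t) (c \<^bold>* t \<^bold>+ d \<^bold>* t)"
\<comment> \<open>category axioms, with bilinear composition\<close>
| cmp_assoc: "typed u c d \<Longrightarrow> typed t b c \<Longrightarrow> typed s a b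
    \<Longrightarrow> ab_eq a d (u \<^bold>\<cdot> t \<^bold>\<cdot> s) (u \<^bold>\<cdot> (t \<^bold>\<cdot> s))"
| id_cmp: "typed t a b \<Longrightarrow> ab_eq a b (Idm b \<^bold>\<cdot> t) t"
| cmp_id: "typed t a b \<Longrightarrow> ab_eq a b (t \<^bold>\<cdot> Idm a) t"
| cmp_add_left: "typed t b c \<Longrightarrow> typed t' b c \<Longrightarrow> typed s a b
    \<Longrightarrow> ab_eq a c ((t \<^bold>+ t') \<^bold>\<cdot> s) (t \<^bold>\<cdot> s \<^bold>+ t' \<^bold>\<cdot> s)"
| cmp_add_right: "typed t b c \<Longrightarrow> typed s a b \<Longrightarrow> typed s' a b
    \<Longrightarrow> ab_eq a c (t \<^bold>\<cdot> (s \<^bold>+ s')) (t \<^bold>\<cdot> s \<^bold>+ t \<^bold>\<cdot> s')"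
| cmp_scl_left: "typed t b c \<Longrightarrow> typed s a b \<Longrightarrow> ab_eq a c ((k \<^bold>* t) \<^bold>\<cdot> s) (k \<^bold>* (t \<^bold>\<cdot> s))"
| cmp_scl_right: "typed t b c \<Longrightarrow> typed s a b \<Longrightarrow> ab_eq a c (t \<^bold>\<cdot> (k \<^bold>* s)) (k \<^bold>* (t \<^bold>\<cdot> s))"
\<comment> \<open>strict monoidal structure, with bilinear tensor product\<close>
| interchange: "typed t b c \<Longrightarrow> typed s a b \<Longrightarrow> typed t' b' c' \<Longrightarrow> typed s' a' b'
    \<Longrightarrow> ab_eq (a + a') (c + c') ((t \<^bold>\<otimes> t') \<^bold>\<cdot> (s \<^bold>\<otimes> s')) ((t \<^bold>\<cdot> s) \<^bold>\<otimes> (t' \<^bold>\<cdot> s'))"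
| tens_id: "ab_eq (a + b) (a + b) (Idm a \<^bold>\<otimes> Idm b) (Idm (a + b))"
| tens_assoc: "typed s a b \<Longrightarrow> typed t c d \<Longrightarrow> typed u e f
    \<Longrightarrow> ab_eq (a + c + e) (b + d + f) (s \<^bold>\<otimes> t \<^bold>\<otimes> u) (s \<^bold>\<otimes> (t \<^bold>\<otimes> u))"
| unit_tens: "typed t a b \<Longrightarrow> ab_eq a b (Idm 0 \<^bold>\<otimes> t) t"
| tens_unit: "typed t a b \<Longrightarrow> ab_eq a b (t \<^bold>\<otimes> Idm 0) t"
| tens_add_left: "typed s a b \<Longrightarrow> typed s' a b \<Longrightarrow> typed t c d
    \<Longrightarrow> ab_eq (a + c) (b + d) ((s \<^bold>+ s') \<^bold>\<otimes> t) (s \<^bold>\<otimes> t \<^bold>+ s' \<^bold>\<otimes> t)"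
| tens_add_right: "typed s a b \<Longrightarrow> typed t c d \<Longrightarrow> typed t' c d
    \<Longrightarrow> ab_eq (a + c) (b + d) (s \<^bold>\<otimes> (t \<^bold>+ t')) (s \<^bold>\<otimes> t \<^bold>+ s \<^bold>\<otimes> t')"
| tens_scl_left: "typed s a b \<Longrightarrow> typed t c d
    \<Longrightarrow> ab_eq (a + c) (b + d) ((k \<^bold>* s) \<^bold>\<otimes> t) (k \<^bold>* (s \<^bold>\<otimes> t))"
| tens_scl_right: "typed s a b \<Longrightarrow> typed t c d
    \<Longrightarrow> ab_eq (a + c) (b + d) (s \<^bold>\<otimes> (k \<^bold>* t)) (k \<^bold>* (s \<^bold>\<otimes> t))"
\<comment> \<open>defining relations\<close>
| relation: "ab_relation s t \<Longrightarrow> typed s a b \<Longrightarrow> typed t a b \<Longrightarrow> ab_eq a b s t"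

text \<open>The morphism denoted by an expression, as a set of expressions.\<close>

definition ab_class :: "'k::field ab_term \<Rightarrow> 'k ab_term set" where
  "ab_class t = {s. \<exists>a b. ab_eq a b t s}"

definition AB :: "(nat, 'k::field ab_term set, 'k) monoidal_category" where
  "AB =
    \<lparr> hom = (\<lambda>a b. ab_class ` {t. typed t a b}),
      idm = (\<lambda>a. ab_class (Idm a)),
      cmp = (\<lambda>G F. \<Union>g \<in> G. \<Union>f \<in> F. ab_class (g \<^bold>\<cdot> f)),
      zer = (\<lambda>a b. ab_class (Zer a b)),
      add = (\<lambda>F G. \<Union>f \<in> F. \<Union>g \<in> G. ab_class (f \<^bold>+ g)),
      scl = (\<lambda>c F. \<Union>f \<in> F. ab_class (c \<^bold>* f)),
      unit_ob = 0,
      tens_ob = (+),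
      tens = (\<lambda>F G. \<Union>f \<in> F. \<Union>g \<in> G. ab_class (f \<^bold>\<otimes> g)) \<rparr>"

primrec type_of :: "'k ab_term \<Rightarrow> nat \<times> nat" where
  "type_of (Idm n) = (n, n)"
| "type_of Cap = (2, 0)"
| "type_of Cup = (0, 2)"
| "type_of Swap = (2, 2)"
| "type_of Dot = (1, 1)"
| "type_of (Zer a b) = (a, b)"
| "type_of (s \<^bold>+ t) = type_of s"
| "type_of (c \<^bold>* t) = type_of t"
| "type_of (t \<^bold>\<cdot> s) = (fst (type_of s), snd (type_of t))"
| "type_of (s \<^bold>\<otimes> t) = (fst (type_of s) + fst (type_of t), snd (type_of s) + snd (type_of t))"

lemma typed_type_of: "typed t a b \<Longrightarrow> type_of t = (a, b)"
  by (induction rule: typed.induct) simp_all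

lemma typed_unique: "typed t a b \<Longrightarrow> typed t a' b' \<Longrightarrow> a = a' \<and> b = b'"
  by (metis typed_type_of prod.inject)

lemma ab_eq_typed: "ab_eq a b s t \<Longrightarrow> typed s a b \<and> typed t a b"
proof (induction rule: ab_eq.induct)
  case (tens_assoc s a b t c d u e f)
  show ?case
    using typed.intros(10)[OF typed.intros(10)[OF tens_assoc(1,2)] tens_assoc(3)]
      typed.intros(10)[OF tens_assoc(1) typed.intros(10)[OF tens_assoc(2,3)]]
    by (simp add: add.assoc)
next
  case (unit_tens t a b)
  show ?case
    using typed.intros(10)[OF typed.intros(1)[of 0] unit_tens] unit_tens by simp
next
  case (tens_unit t a b)
  show ?case
    using typed.intros(10)[OF tens_unit typed.intros(1)[of 0]] tens_unit by simp
qed ((elim conjE)?, intro conjI, (assumption | rule typed.intros)+)+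

lemma mem_ab_class_iff:
  assumes "typed t a b"
  shows "s \<in> ab_class t \<longleftrightarrow> ab_eq a b t s"
proof
  assume "s \<in> ab_class t"
  then obtain a' b' where *: "ab_eq a' b' t s"
    by (auto simp: ab_class_def)
  then have "a = a'" "b = b'"
    using assms ab_eq_typed[OF *] by (blast dest: typed_unique)+
  then show "ab_eq a b t s"
    using * by simp
qed (auto simp: ab_class_def)

lemma ab_class_eq_iff:
  assumes "typed s a b" "typed t a b"
  shows "ab_class s = ab_class t \<longleftrightarrow> ab_eq a b s t"
proof
  assume "ab_class s = ab_class t"
  then show "ab_eq a b s t"
    using ab_eq.refl[OF assms(2)] mem_ab_class_iff[OF assms(1)] mem_ab_class_iff[OF assms(2)]
    by simp
next
  assume st: "ab_eq a b s t"
  have "ab_eq a b s u \<longleftrightarrow> ab_eq a b t u" for u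
    using ab_eq.trans[OF st] ab_eq.trans[OF ab_eq.sym[OF st]] by metis
  then show "ab_class s = ab_class t"
    using mem_ab_class_iff[OF assms(1)] mem_ab_class_iff[OF assms(2)] by (simp add: set_eq_iff)
qed

lemma AB_hom_disjoint:
  assumes "f \<in> hom AB a b" "f \<in> hom AB a' b'"
  shows "a = a' \<and> b = b'"
proof -
  obtain s where s: "typed s a b" "f = ab_class s"
    using assms(1) by (auto simp: AB_def)
  obtain t where t: "typed t a' b'" "f = ab_class t"
    using assms(2) by (auto simp: AB_def)
  have "ab_eq a' b' t s"
    using ab_eq.refl[OF s(1)] mem_ab_class_iff[OF s(1)] mem_ab_class_iff[OF t(1)] s(2) t(2)
    by simp
  then have "typed s a' b'"
    by (blast dest: ab_eq_typed)
  then show ?thesis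
    using s(1) by (blast dest: typed_unique)
qed


section \<open>Cyclotomic Brauer categories\<close>

definition cap :: "'k::field ab_term set" where "cap = ab_class Cap"
definition cup :: "'k::field ab_term set" where "cup = ab_class Cup"
definition dot :: "'k::field ab_term set" where "dot = ab_class Dot"

definition bubble :: "nat \<Rightarrow> 'k::field ab_term set" where
  "bubble n = cmp AB cap (cmp AB (tens AB (idm AB 1) (epow AB 1 dot n)) cup)"

text \<open>
  Power series in \<open>u\<^sup>-\<^sup>1\<close> are formal power series in the variable \<open>fps_X = u\<^sup>-\<^sup>1\<close>; thus
  \<open>2u/(2u-1) = 2/(2 - u\<^sup>-\<^sup>1)\<close>. A power series with coefficients in the endomorphism algebra of the
  unit object is given by its sequence of coefficients: \<open>beta k\<close> is the coefficient of \<open>u\<^sup>-\<^sup>k\<close> in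
  \<open>1 + 2u/(2u-1) (\<Sum>n. bubble n u\<^sup>-\<^sup>n\<^sup>-\<^sup>1)\<close>.
\<close>

fun beta :: "nat \<Rightarrow> 'k::field ab_term set" where
  "beta 0 = idm AB 0"
| "beta (Suc r) =
    lsum AB 0 0 (\<lambda>n. scl AB (fps_nth (2 / (2 - fps_X)) (r - n)) (bubble n)) (Suc r)"

text \<open>The series \<open>\<O>\<close> is a formal power series in \<open>u\<^sup>-\<^sup>1\<close>; its coefficient \<open>\<O>\<^sup>(\<^sup>r\<^sup>)\<close> of
  \<open>u\<^sup>-\<^sup>r\<^sup>-\<^sup>1\<close> is \<open>fps_nth \<O> (Suc r)\<close>.\<close>

definition cyclotomic_generators ::
  "'k::field poly \<Rightarrow> 'k fps \<Rightarrow> nat \<Rightarrow> nat \<Rightarrow> 'k ab_term set set" where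
  "cyclotomic_generators p \<O> a b =
    (if a = 1 \<and> b = 1 then {end_poly AB 1 dot p}
     else if a = 0 \<and> b = 0 then
       {sub AB (beta (Suc r)) (scl AB (fps_nth \<O> (Suc r)) (idm AB 0)) | r. True}
     else {})"

definition cyclotomic_ideal ::
  "'k::field poly \<Rightarrow> 'k fps \<Rightarrow> nat \<Rightarrow> nat \<Rightarrow> 'k ab_term set set" where
  "cyclotomic_ideal p \<O> = generated_left_tensor_ideal AB (cyclotomic_generators p \<O>)"

definition CB :: "'k::field poly \<Rightarrow> 'k fps
    \<Rightarrow> (nat, 'k ab_term set, nat, 'k ab_term set set, 'k) module_category" where
  "CB p \<O> = quotient_category AB (cyclotomic_ideal p \<O>)"

text \<open>The minimal polynomial of the dot, acting on the image of the unit object.\<close>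

definition m_L :: "'k::field poly \<Rightarrow> 'k fps \<Rightarrow> 'k poly" where
  "m_L p \<O> = end_min_poly (CB p \<O>) 1 (coset AB (cyclotomic_ideal p \<O>) dot)"

text \<open>
  The expansion in \<open>u\<^sup>-\<^sup>1\<close> of \<open>((-1)\<^sup>d u - 1/2) f(-u) / ((u - 1/2) f(u))\<close>, \<open>d = deg f\<close>. Numerator
  and denominator have the same degree \<open>d + 1\<close>, and \<open>reflect_poly\<close> divides each of them by
  \<open>u\<^sup>d\<^sup>+\<^sup>1\<close>; see \<open>fps_to_fls_O_poly\<close>.
\<close>

definition O_poly :: "'k::field poly \<Rightarrow> 'k fps" where
  "O_poly f =
    fps_of_poly (reflect_poly ([:- (1/2), (-1) ^ degree f:] * pcompose f [:0, -1:])) /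
    fps_of_poly (reflect_poly ([:- (1/2), 1:] * f))"

definition CB_poly :: "'k::field poly
    \<Rightarrow> (nat, 'k ab_term set, nat, 'k ab_term set set, 'k) module_category" where
  "CB_poly m = CB m (O_poly m)"

definition fls_poly :: "'k::field poly \<Rightarrow> 'k fls \<Rightarrow> 'k fls" where
  "fls_poly f v = poly (map_poly fls_const f) v"

lemma fls_poly_pCons [simp]: "fls_poly (pCons c f) v = fls_const c + v * fls_poly f v"
  by (cases "c = 0 \<and> f = 0") (auto simp: fls_poly_def map_poly_pCons)

lemma fls_poly_0 [simp]: "fls_poly 0 v = 0"
  by (simp add: fls_poly_def)

lemma fls_poly_add: "fls_poly (f + g) v = fls_poly f v + fls_poly g v"
proof (induction f arbitrary: g)
  case 0
  then show ?case by simp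
next
  case (pCons c f)
  then show ?case
    by (cases g) (simp add: algebra_simps fls_plus_const)
qed

lemma fls_poly_smult: "fls_poly (smult c f) v = fls_const c * fls_poly f v"
  by (induction f) (simp_all add: algebra_simps flip: fls_const_mult_const)

lemma fls_poly_mult: "fls_poly (f * g) v = fls_poly f v * fls_poly g v"
  by (induction f) (simp_all add: fls_poly_add fls_poly_smult algebra_simps)

lemma fls_poly_pcompose: "fls_poly (pcompose f g) v = fls_poly f (fls_poly g v)"
  by (induction f) (simp_all add: pcompose_pCons fls_poly_add fls_poly_mult)

lemma fls_poly_reflect_poly:
  "fps_to_fls (fps_of_poly (reflect_poly f)) = fls_X ^ degree f * fls_poly f fls_X_inv"
proof (induction f)
  case 0
  then show ?case by simp
next
  case (pCons c f)
  have X: "fls_X * fls_X_inv = (1 :: 'a fls)"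
    by (metis fls_X_nonzero fls_inverse_X right_inverse)
  show ?case
  proof (cases "f = 0")
    case True
    then show ?thesis by (simp add: fps_of_poly_const)
  next
    case False
    have "reflect_poly (pCons c f) = reflect_poly f + monom c (degree f + 1)"
      using False by (simp add: reflect_poly_pCons')
    moreover have "fls_X ^ Suc (degree f) * (fls_const c + fls_X_inv * fls_poly f fls_X_inv)
      = fls_X ^ Suc (degree f) * fls_const c
        + (fls_X * fls_X_inv) * (fls_X ^ degree f * fls_poly f fls_X_inv)"
      by (simp add: algebra_simps)
    ultimately show ?thesis
      using False pCons.IH X
      by (simp add: fps_of_poly_add fps_of_poly_monom fls_times_fps_to_fls fps_to_fls_power
          algebra_simps)
  qed
qed

lemma fps_to_fls_O_poly:
  fixes f :: "'k::field poly"
  assumes "f \<noteq> 0"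
  defines "u \<equiv> (fls_X_inv :: 'k fls)"
  shows "fps_to_fls (O_poly f) =
    ((-1) ^ degree f * u - fls_const (1/2)) * fls_poly f (- u)
      / ((u - fls_const (1/2)) * fls_poly f u)"
proof -
  let ?N = "[:- (1/2), (-1) ^ degree f:] * pcompose f [:0, -1::'k:]"
  let ?D = "[:- (1/2), 1:] * f"
  have degN: "degree ?N = Suc (degree f)"
  proof -
    have "pcompose f [:0, -1:] \<noteq> 0"
      using assms(1) by (simp add: pcompose_eq_0_iff)
    then show ?thesis
      by (subst degree_mult_eq) (simp_all add: degree_pcompose)
  qed
  have degD: "degree ?D = Suc (degree f)"
    using assms(1) by (subst degree_mult_eq) simp_all
  have "?D \<noteq> 0"
    using degD by (metis degree_0 nat.distinct(1))
  then have "subdegree (fps_of_poly (reflect_poly ?D)) = 0"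
    by (simp only: subdegree_eq_0_iff fps_of_poly_nth coeff_0_reflect_poly leading_coeff_0_iff) simp
  then have "fps_to_fls (O_poly f) = fps_to_fls (fps_of_poly (reflect_poly ?N))
      / fps_to_fls (fps_of_poly (reflect_poly ?D))"
    unfolding O_poly_def by (intro fls_divide_fps_to_fls[symmetric]) simp
  also have "\<dots> = fls_poly ?N u / fls_poly ?D u"
    unfolding fls_poly_reflect_poly degN degD u_def by simp
  also have "\<dots> = fls_poly [:- (1/2), (-1) ^ degree f:] u * fls_poly f (fls_poly [:0, -1:] u)
      / (fls_poly [:- (1/2), 1:] u * fls_poly f u)"
    by (simp only: fls_poly_mult fls_poly_pcompose)
  also have "fls_poly [:0, -1:] u = - u"
    by simp
  also have "fls_poly [:- (1/2), (-1) ^ degree f:] u = (-1) ^ degree f * u - fls_const (1/2)"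
    by (cases "even (degree f)") simp_all
  also have "fls_poly [:- (1/2), 1:] u = u - fls_const (1/2)"
    by simp
  finally show ?thesis .
qed

end

theory Submission
  imports Defs
begin

text \<open>
  Write \<open>m\<close> for the minimal polynomial of the dot. The two categories are equal, and the isomorphism
  is the identity: the left tensor ideals by which the affine Brauer category is divided coincide.

  For a fixed series \<open>\<O>\<close>, replacing \<open>p\<close> by \<open>m\<close> does not change the ideal, since \<open>m(x)\<close> lies in the ideal
  generated by \<open>p(x)\<close> and the bubble relations, and \<open>p\<close> is a multiple of \<open>m\<close>
  (\<open>cyclotomic_ideal_mono\<close>). The point is therefore that \<open>\<O>\<close> is forced to be \<open>\<O>\<^sub>m\<close>
  (\<open>series_determined_by_min_poly\<close>). Everything is computed modulo the ideal, where the bubble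
  \<open>cap (I \<otimes> x\<^sup>n) cup\<close> is a scalar \<open>b\<^sub>n\<close> that the coefficients of \<open>\<O>\<close> determine
  (\<open>bubble_scalars\<close>), and where \<open>c(q)\<close> denotes \<open>cap (I \<otimes> q(x))\<close>.

  First, \<open>u\<^sup>n m(u)\<close> kills the dot for all \<open>n\<close>, and closing up the strand turns this into the linear recurrence
  with characteristic polynomial \<open>m\<close> for the \<open>b\<^sub>n\<close> (\<open>moment_eq_0\<close>). Hence
  \<open>m(u) \<Sum>\<^sub>n b\<^sub>n u\<^sup>-\<^sup>n\<^sup>-\<^sup>1\<close> is a polynomial \<open>g(u)\<close> and \<open>\<O>\<close> is rational, with
  denominator \<open>(u - 1/2) m(u)\<close>. This alone does not determine the numerator.

  Second, pulling the dots of \<open>c(q)\<close> one by one through a crossing attached below gives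
  \<open>c(q) s = c(q')\<close> for an explicit polynomial \<open>q'\<close>, the \<open>curl\<close> of \<open>q\<close>, which depends on the \<open>b\<^sub>n\<close>
  (\<open>cap_poly_swap\<close>). For \<open>q = m\<close> the left-hand side vanishes; straightening the cap,
  \<open>m'(x) = 0\<close>, so \<open>m\<close> divides \<open>m'\<close>. Now \<open>m'\<close> has degree at most \<open>d = deg m\<close> and its coefficient of \<open>u\<^sup>d\<close> is
  \<open>(-1)\<^sup>d\<close>, so \<open>m' = (-1)\<^sup>d m\<close> (\<open>curl_min_poly\<close>). Minimality of \<open>m\<close> is used exactly here. On the other hand
  \<open>2u m'(u) = 2u m(-u) + m(-u) - m(u) + 2u g(-u)\<close> (\<open>curl_eq_poly_part\<close>). The two expressions for
  \<open>m'\<close> determine \<open>g\<close>, hence the numerator of \<open>\<O>\<close> (\<open>series_eq_O_poly\<close>).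
\<close>

section \<open>Calculus of expressions modulo a left tensor ideal\<close>

text \<open>
  Together with \<open>type_of\<close> this makes typing computable, so that the side conditions of all
  equational rules below are settled by simplification (see \<open>typed_iff\<close>).
\<close>

primrec well_typed :: "'k ab_term \<Rightarrow> bool" where
  "well_typed (Idm n) \<longleftrightarrow> True"
| "well_typed Cap \<longleftrightarrow> True"
| "well_typed Cup \<longleftrightarrow> True"
| "well_typed Swap \<longleftrightarrow> True"
| "well_typed Dot \<longleftrightarrow> True"
| "well_typed (Zer a b) \<longleftrightarrow> True"
| "well_typed (s \<^bold>+ t) \<longleftrightarrow> well_typed s \<and> well_typed t \<and> type_of s = type_of t"
| "well_typed (c \<^bold>* t) \<longleftrightarrow> well_typed t"
| "well_typed (t \<^bold>\<cdot> s) \<longleftrightarrow> well_typed t \<and> well_typed s \<and> fst (type_of t) = snd (type_of s)"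
| "well_typed (s \<^bold>\<otimes> t) \<longleftrightarrow> well_typed s \<and> well_typed t"

lemma well_typed_imp_typed: "well_typed t \<Longrightarrow> typed t (fst (type_of t)) (snd (type_of t))"
proof (induction t)
  case (Cmp t s)
  then show ?case by (auto intro: typed.intros)
next
  case Dot
  show ?case using typed.intros(5) by simp
qed (auto intro: typed.intros)

lemma typed_imp_well_typed: "typed t a b \<Longrightarrow> well_typed t"
  by (induction rule: typed.induct) (auto simp: typed_type_of)

lemma typed_iff: "typed t a b \<longleftrightarrow> well_typed t \<and> type_of t = (a, b)"
  using well_typed_imp_typed typed_imp_well_typed typed_type_of by (metis fst_conv snd_conv)

lemma AB_simps:
  "hom AB a b = ab_class ` {t. typed t a b}"
  "idm AB a = ab_class (Idm a)"
  "zer AB a b = ab_class (Zer a b)"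
  "tens_ob AB = (+)"
  by (simp_all add: AB_def)

lemma ab_class_cong: "ab_eq a b s t \<Longrightarrow> ab_class s = ab_class t"
  using ab_class_eq_iff ab_eq_typed by blast

text \<open>
  The operations of \<open>AB\<close> are unions over representatives; by congruence all the united classes
  coincide, so each operation can be computed on any one representative.
\<close>

lemma ab_class_UN:
  assumes "typed t a b" and "\<And>s. ab_eq a b t s \<Longrightarrow> ab_eq c d (f t) (f s)"
  shows "(\<Union>s \<in> ab_class t. ab_class (f s)) = ab_class (f t)"
proof -
  have "ab_class (f s) = ab_class (f t)" if "s \<in> ab_class t" for s
    using that assms mem_ab_class_iff[OF assms(1)] ab_class_cong by blast
  moreover have "t \<in> ab_class t"
    using assms(1) by (simp add: mem_ab_class_iff ab_eq.refl)
  ultimately show ?thesis by blast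
qed

lemma ab_class_UN2:
  assumes "typed t a b" "typed t' a' b'"
    and "\<And>s s'. ab_eq a b t s \<Longrightarrow> ab_eq a' b' t' s' \<Longrightarrow> ab_eq c d (f t t') (f s s')"
  shows "(\<Union>s \<in> ab_class t. \<Union>s' \<in> ab_class t'. ab_class (f s s')) = ab_class (f t t')"
proof -
  have "ab_class (f s s') = ab_class (f t t')" if "s \<in> ab_class t" "s' \<in> ab_class t'" for s s'
    using that assms mem_ab_class_iff[OF assms(1)] mem_ab_class_iff[OF assms(2)] ab_class_cong
    by metis
  moreover have "t \<in> ab_class t" "t' \<in> ab_class t'"
    using assms(1,2) by (simp_all add: mem_ab_class_iff ab_eq.refl)
  ultimately show ?thesis by blast
qed

lemma cmp_AB: "well_typed (t \<^bold>\<cdot> s) \<Longrightarrow> cmp AB (ab_class t) (ab_class s) = ab_class (t \<^bold>\<cdot> s)"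
  unfolding AB_def linear_category.simps
  by (rule ab_class_UN2[OF well_typed_imp_typed well_typed_imp_typed])
    (auto intro: ab_eq.cmp_cong)

lemma add_AB: "well_typed (s \<^bold>+ t) \<Longrightarrow> add AB (ab_class s) (ab_class t) = ab_class (s \<^bold>+ t)"
  unfolding AB_def linear_category.simps
  by (rule ab_class_UN2[OF well_typed_imp_typed well_typed_imp_typed])
    (auto intro: ab_eq.add_cong)

lemma scl_AB: "well_typed t \<Longrightarrow> scl AB c (ab_class t) = ab_class (c \<^bold>* t)"
  unfolding AB_def linear_category.simps
  by (rule ab_class_UN[OF well_typed_imp_typed]) (auto intro: ab_eq.scl_cong)

lemma tens_AB:
  "well_typed s \<Longrightarrow> well_typed t \<Longrightarrow> tens AB (ab_class s) (ab_class t) = ab_class (s \<^bold>\<otimes> t)"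
  unfolding AB_def monoidal_category.simps
  by (rule ab_class_UN2[OF well_typed_imp_typed well_typed_imp_typed])
    (auto intro: ab_eq.tens_cong)

lemma sub_AB: "well_typed (s \<^bold>+ t) \<Longrightarrow> sub AB (ab_class s) (ab_class t) = ab_class (s \<^bold>+ (-1) \<^bold>* t)"
  by (simp add: sub_def scl_AB add_AB)

lemma hom_AB_E:
  assumes "f \<in> hom AB a b"
  obtains t where "typed t a b" "f = ab_class t"
  using assms by (auto simp: AB_simps)

lemma left_tensor_idealD:
  assumes "left_tensor_ideal C I"
  shows "I a b \<subseteq> hom C a b"
    and "zer C a b \<in> I a b"
    and "f \<in> I a b \<Longrightarrow> g \<in> I a b \<Longrightarrow> add C f g \<in> I a b"
    and "f \<in> I a b \<Longrightarrow> scl C c f \<in> I a b"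
    and "f \<in> I a b \<Longrightarrow> h \<in> hom C b d \<Longrightarrow> cmp C h f \<in> I a d"
    and "f \<in> I a b \<Longrightarrow> h \<in> hom C d a \<Longrightarrow> cmp C f h \<in> I d b"
    and "f \<in> I a b \<Longrightarrow> tens C (idm C x) f \<in> I (tens_ob C x a) (tens_ob C x b)"
proof -
  note 1 = assms[unfolded left_tensor_ideal_def, THEN conjunct1, rule_format, of a b]
    and 2 = assms[unfolded left_tensor_ideal_def, THEN conjunct2]
  show "I a b \<subseteq> hom C a b" "zer C a b \<in> I a b"
    using 1 by blast+
  show "f \<in> I a b \<Longrightarrow> g \<in> I a b \<Longrightarrow> add C f g \<in> I a b"
    "f \<in> I a b \<Longrightarrow> scl C c f \<in> I a b"
    using 1 by blast+
  show "f \<in> I a b \<Longrightarrow> h \<in> hom C b d \<Longrightarrow> cmp C h f \<in> I a d"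
    "f \<in> I a b \<Longrightarrow> h \<in> hom C d a \<Longrightarrow> cmp C f h \<in> I d b"
    "f \<in> I a b \<Longrightarrow> tens C (idm C x) f \<in> I (tens_ob C x a) (tens_ob C x b)"
    using 2 by blast+
qed

text \<open>
  The largest left tensor ideal. It guarantees that the intersection defining a generated ideal
  runs over a nonempty family.
\<close>

lemma left_tensor_ideal_hom:
  "left_tensor_ideal AB (hom (AB :: (nat, 'k::field ab_term set, 'k) monoidal_category))"
  unfolding left_tensor_ideal_def
proof (intro conjI allI ballI)
  let ?AB = "AB :: (nat, 'k ab_term set, 'k) monoidal_category"
  show "zer AB a b \<in> hom AB a b" for a b
    by (auto simp: AB_simps intro: typed.intros)
  show "add AB f g \<in> hom AB a b" if "f \<in> hom AB a b" "g \<in> hom AB a b" for a b and f g :: "'k ab_term set"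
    using that by (elim hom_AB_E) (auto simp: AB_simps add_AB typed_iff)
  show "scl AB c f \<in> hom AB a b" if "f \<in> hom AB a b" for a b c and f :: "'k ab_term set"
    using that by (elim hom_AB_E) (auto simp: AB_simps scl_AB typed_iff)
  show "cmp AB g f \<in> hom AB a c" if "f \<in> hom AB a b" "g \<in> hom AB b c" for a b c and f g :: "'k ab_term set"
    using that by (elim hom_AB_E) (auto simp: AB_simps cmp_AB typed_iff)
  show "cmp AB g f \<in> hom AB a c" if "f \<in> hom AB a b" "g \<in> hom AB b c" for a b c and f g :: "'k ab_term set"
    using that by (elim hom_AB_E) (auto simp: AB_simps cmp_AB typed_iff)
  show "tens AB (idm AB x) f \<in> hom AB (tens_ob ?AB x a) (tens_ob ?AB x b)" if "f \<in> hom AB a b"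
    for x a b and f :: "'k ab_term set"
    using that by (elim hom_AB_E) (auto simp: AB_simps tens_AB typed_iff)
qed simp

lemma left_tensor_ideal_generated:
  fixes G :: "nat \<Rightarrow> nat \<Rightarrow> 'k::field ab_term set set"
  assumes "\<And>a b. G a b \<subseteq> hom AB a b"
  shows "left_tensor_ideal AB (generated_left_tensor_ideal AB G)"
proof -
  let ?AB = "AB :: (nat, 'k ab_term set, 'k) monoidal_category"
  let ?I = "generated_left_tensor_ideal AB G"
  have mem: "f \<in> ?I a b \<longleftrightarrow>
      (\<forall>I. left_tensor_ideal AB I \<longrightarrow> (\<forall>a b. G a b \<subseteq> I a b) \<longrightarrow> f \<in> I a b)" for f a b
    unfolding generated_left_tensor_ideal_def by blast
  have "?I a b \<subseteq> hom AB a b" for a b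
    using mem left_tensor_ideal_hom assms by blast
  then show ?thesis
    unfolding left_tensor_ideal_def
  proof (intro conjI allI ballI)
    fix a b
    show "zer AB a b \<in> ?I a b"
      unfolding mem by (simp add: left_tensor_idealD)
    show "add AB f g \<in> ?I a b" if "f \<in> ?I a b" "g \<in> ?I a b" for f g
      using that unfolding mem by (simp add: left_tensor_idealD)
    show "scl AB c f \<in> ?I a b" if "f \<in> ?I a b" for c f
      using that unfolding mem by (simp add: left_tensor_idealD)
    show "cmp AB g f \<in> ?I a c" if "f \<in> ?I a b" "g \<in> hom AB b c" for c f g
      using that unfolding mem by (blast intro: left_tensor_idealD(5,6))
    show "cmp AB g f \<in> ?I a c" if "f \<in> hom AB a b" "g \<in> ?I b c" for c f g
      using that unfolding mem by (blast intro: left_tensor_idealD(5,6))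
    show "tens AB (idm AB x) f \<in> ?I (tens_ob ?AB x a) (tens_ob ?AB x b)" if "f \<in> ?I a b" for x f
      using that unfolding mem by (blast intro: left_tensor_idealD(7))
  qed
qed

lemma generated_left_tensor_ideal_least:
  assumes "left_tensor_ideal C I" "\<And>a b. G a b \<subseteq> I a b"
  shows "generated_left_tensor_ideal C G a b \<subseteq> I a b"
  unfolding generated_left_tensor_ideal_def using assms by blast

lemma generated_left_tensor_ideal_superset: "G a b \<subseteq> generated_left_tensor_ideal C G a b"
  unfolding generated_left_tensor_ideal_def by blast

declare ab_eq.trans [trans]

locale left_ideal =
  fixes J :: "nat \<Rightarrow> nat \<Rightarrow> 'k::field ab_term set set"
  assumes left_tensor_ideal: "left_tensor_ideal AB J"
begin

text \<open>
  Equality modulo a left tensor ideal \<open>J\<close>. The relation is phrased by adding an element of \<open>J\<close> on the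
  right, instead of requiring the difference to lie in \<open>J\<close>: in this form the
  congruence rules follow by expanding sums and need no subtraction.
\<close>

definition eqv :: "'k ab_term \<Rightarrow> 'k ab_term \<Rightarrow> bool"  (infix "\<simeq>" 50) where
  "s \<simeq> t \<longleftrightarrow> (\<exists>a b n. ab_eq a b s (t \<^bold>+ n) \<and> ab_class n \<in> J a b)"

lemma J_zer: "ab_class (Zer a b) \<in> J a b"
  using left_tensor_ideal by (auto simp: left_tensor_ideal_def AB_simps)

lemma J_add: "well_typed (s \<^bold>+ t) \<Longrightarrow> ab_class s \<in> J a b \<Longrightarrow> ab_class t \<in> J a b \<Longrightarrow> ab_class (s \<^bold>+ t) \<in> J a b"
  using left_tensor_idealD(3)[OF left_tensor_ideal] add_AB by metis

lemma J_scl: "well_typed t \<Longrightarrow> ab_class t \<in> J a b \<Longrightarrow> ab_class (c \<^bold>* t) \<in> J a b"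
  using left_tensor_idealD(4)[OF left_tensor_ideal] scl_AB by metis

lemma J_cmp_left:
  assumes "typed t b c" "typed s a b" "ab_class s \<in> J a b"
  shows "ab_class (t \<^bold>\<cdot> s) \<in> J a c"
proof -
  have "ab_class t \<in> hom AB b c"
    using assms by (auto simp: AB_simps)
  then have "cmp AB (ab_class t) (ab_class s) \<in> J a c"
    using left_tensor_ideal assms(3) unfolding left_tensor_ideal_def by blast
  then show ?thesis
    using assms by (simp add: cmp_AB typed_iff)
qed

lemma J_cmp_right:
  assumes "typed t b c" "typed s a b" "ab_class t \<in> J b c"
  shows "ab_class (t \<^bold>\<cdot> s) \<in> J a c"
proof -
  have "ab_class s \<in> hom AB a b"
    using assms by (auto simp: AB_simps)
  then have "cmp AB (ab_class t) (ab_class s) \<in> J a c"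
    using left_tensor_ideal assms(3) unfolding left_tensor_ideal_def by blast
  then show ?thesis
    using assms by (simp add: cmp_AB typed_iff)
qed

lemma J_tens:
  assumes "typed t a b" "ab_class t \<in> J a b"
  shows "ab_class (Idm x \<^bold>\<otimes> t) \<in> J (x + a) (x + b)"
proof -
  have "tens AB (idm AB x) (ab_class t) \<in> J (x + a) (x + b)"
    using left_tensor_ideal assms(2) unfolding left_tensor_ideal_def AB_simps by blast
  then show ?thesis
    using assms by (simp add: tens_AB AB_simps typed_iff)
qed

lemma eqvE:
  assumes "s \<simeq> t"
  obtains a b n where "typed s a b" "typed t a b" "typed n a b" "ab_class n \<in> J a b"
    "ab_eq a b s (t \<^bold>+ n)"
proof -
  obtain a b n where *: "ab_eq a b s (t \<^bold>+ n)" "ab_class n \<in> J a b"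
    using assms unfolding eqv_def by blast
  then have "typed s a b" "typed t a b" "typed n a b"
    using ab_eq_typed[OF *(1)] by (auto simp: typed_iff)
  then show thesis using that * by blast
qed

lemma eqvI: "ab_eq a b s (t \<^bold>+ n) \<Longrightarrow> ab_class n \<in> J a b \<Longrightarrow> s \<simeq> t"
  unfolding eqv_def by blast

lemma eqv_of_ab_eq:
  assumes "ab_eq a b s t"
  shows "s \<simeq> t"
proof (rule eqvI[OF _ J_zer])
  have "typed t a b" using ab_eq_typed[OF assms] by blast
  then show "ab_eq a b s (t \<^bold>+ Zer a b)"
    using assms ab_eq.trans ab_eq.sym ab_eq.add_zero by blast
qed

lemma eqv_type: "s \<simeq> t \<Longrightarrow> well_typed s \<and> well_typed t \<and> type_of s = type_of t"
  by (elim eqvE) (simp add: typed_iff)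

lemma eqv_refl: "well_typed t \<Longrightarrow> t \<simeq> t"
  by (rule eqv_of_ab_eq[OF ab_eq.refl[OF well_typed_imp_typed]])

lemma ab_eq_exchange:
  assumes "typed s a b" "typed t a b" "typed u a b" "typed v a b"
  shows "ab_eq a b ((s \<^bold>+ t) \<^bold>+ (u \<^bold>+ v)) ((s \<^bold>+ u) \<^bold>+ (t \<^bold>+ v))"
proof -
  note ty = assms typed.intros(7)
  have "ab_eq a b ((s \<^bold>+ t) \<^bold>+ (u \<^bold>+ v)) (s \<^bold>+ (t \<^bold>+ (u \<^bold>+ v)))"
    by (intro ab_eq.add_assoc ty)
  also have "ab_eq a b \<dots> (s \<^bold>+ (t \<^bold>+ u \<^bold>+ v))"
    by (intro ab_eq.add_cong ab_eq.refl ab_eq.sym[OF ab_eq.add_assoc] ty)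
  also have "ab_eq a b \<dots> (s \<^bold>+ (u \<^bold>+ t \<^bold>+ v))"
    by (rule ab_eq.add_cong ab_eq.refl ab_eq.add_commute ty)+
  also have "ab_eq a b \<dots> (s \<^bold>+ (u \<^bold>+ (t \<^bold>+ v)))"
    by (rule ab_eq.add_cong[OF ab_eq.refl ab_eq.add_assoc] ty)+
  also have "ab_eq a b \<dots> ((s \<^bold>+ u) \<^bold>+ (t \<^bold>+ v))"
    by (rule ab_eq.sym[OF ab_eq.add_assoc] ty)+
  finally show ?thesis .
qed

lemma eqv_sym:
  assumes "s \<simeq> t"
  shows "t \<simeq> s"
  using assms
proof (rule eqvE)
  fix a b n
  assume *: "typed s a b" "typed t a b" "typed n a b" "ab_class n \<in> J a b" "ab_eq a b s (t \<^bold>+ n)"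
  note ty = * typed.intros
  have "ab_eq a b (s \<^bold>+ (-1) \<^bold>* n) (t \<^bold>+ n \<^bold>+ (-1) \<^bold>* n)"
    by (rule ab_eq.add_cong ab_eq.refl ty)+
  also have "ab_eq a b \<dots> (t \<^bold>+ (n \<^bold>+ (-1) \<^bold>* n))"
    by (rule ab_eq.add_assoc ty)+
  also have "ab_eq a b \<dots> (t \<^bold>+ Zer a b)"
    by (rule ab_eq.add_cong ab_eq.refl ab_eq.add_neg ty)+
  also have "ab_eq a b \<dots> t"
    by (rule ab_eq.add_zero ty)+
  finally have "ab_eq a b (s \<^bold>+ (-1) \<^bold>* n) t" .
  then show "t \<simeq> s"
    using * by (intro eqvI[OF ab_eq.sym J_scl]) (simp_all add: typed_iff)
qed

lemma eqv_trans [trans]: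
  assumes "s \<simeq> t" "t \<simeq> u"
  shows "s \<simeq> u"
  using assms(1)
proof (rule eqvE)
  fix a b n
  assume *: "typed s a b" "typed t a b" "typed n a b" "ab_class n \<in> J a b" "ab_eq a b s (t \<^bold>+ n)"
  from assms(2) show "s \<simeq> u"
  proof (rule eqvE)
    fix a' b' n'
    assume 1: "typed t a' b'" "typed u a' b'" "typed n' a' b'" "ab_class n' \<in> J a' b'"
      "ab_eq a' b' t (u \<^bold>+ n')"
    have [simp]: "a' = a" "b' = b" using typed_unique *(2) 1(1) by blast+
    note ** = 1[simplified]
    have "ab_eq a b s (u \<^bold>+ n' \<^bold>+ n)"
      by (rule ab_eq.trans[OF *(5)], rule ab_eq.add_cong[OF **(5) ab_eq.refl], rule *)
    also have "ab_eq a b \<dots> (u \<^bold>+ (n' \<^bold>+ n))"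
      by (rule ab_eq.add_assoc * **)+
    finally show "s \<simeq> u"
      by (rule eqvI) (use * ** in \<open>auto simp: typed_iff intro: J_add\<close>)
  qed
qed

lemma eqv_add_cong:
  assumes "s \<simeq> s'" "t \<simeq> t'" "well_typed (s \<^bold>+ t)"
  shows "s \<^bold>+ t \<simeq> s' \<^bold>+ t'"
  using assms(1)
proof (rule eqvE)
  fix a b n
  assume *: "typed s a b" "typed s' a b" "typed n a b" "ab_class n \<in> J a b" "ab_eq a b s (s' \<^bold>+ n)"
  from assms(2) show ?thesis
  proof (rule eqvE)
    fix a' b' n'
    assume 1: "typed t a' b'" "typed t' a' b'" "typed n' a' b'" "ab_class n' \<in> J a' b'"
      "ab_eq a' b' t (t' \<^bold>+ n')"
    have [simp]: "a' = a" "b' = b" using *(1) 1(1) assms(3) by (auto simp: typed_iff)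
    note ** = 1[simplified]
    have "ab_eq a b (s \<^bold>+ t) ((s' \<^bold>+ n) \<^bold>+ (t' \<^bold>+ n'))"
      by (rule ab_eq.add_cong * **)+
    also have "ab_eq a b \<dots> ((s' \<^bold>+ t') \<^bold>+ (n \<^bold>+ n'))"
      by (rule ab_eq_exchange * **)+
    finally show ?thesis
      by (rule eqvI) (use * ** in \<open>auto simp: typed_iff intro: J_add\<close>)
  qed
qed

lemma eqv_scl_cong:
  assumes "s \<simeq> t"
  shows "c \<^bold>* s \<simeq> c \<^bold>* t"
  using assms
proof (rule eqvE)
  fix a b n
  assume *: "typed s a b" "typed t a b" "typed n a b" "ab_class n \<in> J a b" "ab_eq a b s (t \<^bold>+ n)"
  have "ab_eq a b (c \<^bold>* s) (c \<^bold>* (t \<^bold>+ n))"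
    by (rule ab_eq.scl_cong *)+
  also have "ab_eq a b \<dots> (c \<^bold>* t \<^bold>+ c \<^bold>* n)"
    by (rule ab_eq.scl_add *)+
  finally show ?thesis
    by (rule eqvI) (use * in \<open>auto simp: typed_iff intro: J_scl\<close>)
qed

lemma eqv_cmp_cong:
  assumes "t \<simeq> t'" "s \<simeq> s'" "well_typed (t \<^bold>\<cdot> s)"
  shows "t \<^bold>\<cdot> s \<simeq> t' \<^bold>\<cdot> s'"
  using assms(1)
proof (rule eqvE)
  fix b c n
  assume *: "typed t b c" "typed t' b c" "typed n b c" "ab_class n \<in> J b c" "ab_eq b c t (t' \<^bold>+ n)"
  from assms(2) show ?thesis
  proof (rule eqvE)
    fix a b' n'
    assume 1: "typed s a b'" "typed s' a b'" "typed n' a b'" "ab_class n' \<in> J a b'"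
      "ab_eq a b' s (s' \<^bold>+ n')"
    have [simp]: "b' = b" using *(1) 1(1) assms(3) by (auto simp: typed_iff)
    note ** = 1[simplified]
    note ty = * ** typed.intros
    have "ab_eq a c (t \<^bold>\<cdot> s) ((t' \<^bold>+ n) \<^bold>\<cdot> s)"
      by (rule ab_eq.cmp_cong ab_eq.refl * **)+
    also have "ab_eq a c \<dots> (t' \<^bold>\<cdot> s \<^bold>+ n \<^bold>\<cdot> s)"
      by (rule ab_eq.cmp_add_left * **)+
    also have "ab_eq a c \<dots> (t' \<^bold>\<cdot> (s' \<^bold>+ n') \<^bold>+ n \<^bold>\<cdot> s)"
      by (rule ab_eq.add_cong ab_eq.cmp_cong ab_eq.refl ty)+
    also have "ab_eq a c \<dots> ((t' \<^bold>\<cdot> s' \<^bold>+ t' \<^bold>\<cdot> n') \<^bold>+ n \<^bold>\<cdot> s)"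
      by (rule ab_eq.add_cong[OF ab_eq.cmp_add_right ab_eq.refl] typed.intros(9) * **)+
    also have "ab_eq a c \<dots> (t' \<^bold>\<cdot> s' \<^bold>+ (t' \<^bold>\<cdot> n' \<^bold>+ n \<^bold>\<cdot> s))"
      by (rule ab_eq.add_assoc typed.intros(9) * **)+
    finally have "ab_eq a c (t \<^bold>\<cdot> s) (t' \<^bold>\<cdot> s' \<^bold>+ (t' \<^bold>\<cdot> n' \<^bold>+ n \<^bold>\<cdot> s))" .
    moreover have "ab_class (t' \<^bold>\<cdot> n') \<in> J a c"
      by (rule J_cmp_left * **)+
    moreover have "ab_class (n \<^bold>\<cdot> s) \<in> J a c"
      by (rule J_cmp_right * **)+
    ultimately show ?thesis
      using * ** by (intro eqvI[of a c _ _ "t' \<^bold>\<cdot> n' \<^bold>+ n \<^bold>\<cdot> s"] J_add) (auto simp: typed_iff)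
  qed
qed

text \<open>
  \<open>J\<close> is only a left tensor ideal, so the relation is compatible with adding strands on the left but not
  on the right. Rewriting in a left tensor factor has to take place in \<open>AB\<close> itself; this is why
  several interchange steps below are carried out for \<open>ab_eq\<close>.
\<close>

lemma eqv_tens_cong:
  assumes "s \<simeq> t"
  shows "Idm x \<^bold>\<otimes> s \<simeq> Idm x \<^bold>\<otimes> t"
  using assms
proof (rule eqvE)
  fix a b n
  assume *: "typed s a b" "typed t a b" "typed n a b" "ab_class n \<in> J a b" "ab_eq a b s (t \<^bold>+ n)"
  have "ab_eq (x + a) (x + b) (Idm x \<^bold>\<otimes> s) (Idm x \<^bold>\<otimes> (t \<^bold>+ n))"
    by (rule ab_eq.tens_cong ab_eq.refl typed.intros(1) *)+
  also have "ab_eq (x + a) (x + b) \<dots> (Idm x \<^bold>\<otimes> t \<^bold>+ Idm x \<^bold>\<otimes> n)"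
    by (rule ab_eq.tens_add_right typed.intros(1) *)+
  finally show ?thesis
    by (rule eqvI) (intro J_tens *)
qed

lemma mem_J_iff:
  assumes "typed t a b"
  shows "ab_class t \<in> J a b \<longleftrightarrow> t \<simeq> Zer a b"
proof
  assume "ab_class t \<in> J a b"
  moreover have "ab_eq a b t (Zer a b \<^bold>+ t)"
    by (rule ab_eq.sym[OF ab_eq.trans[OF ab_eq.add_commute ab_eq.add_zero]] typed.intros assms)+
  ultimately show "t \<simeq> Zer a b" by (rule eqvI[rotated])
next
  assume "t \<simeq> Zer a b"
  then show "ab_class t \<in> J a b"
  proof (rule eqvE)
    fix a' b' n
    assume 1: "typed t a' b'" "typed (Zer a b :: 'k ab_term) a' b'" "typed n a' b'"
      "ab_class n \<in> J a' b'" "ab_eq a' b' t (Zer a b \<^bold>+ n)"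
    have [simp]: "a' = a" "b' = b" using 1(2) by (auto simp: typed_iff)
    note ** = 1[simplified]
    have "ab_eq a b (Zer a b \<^bold>+ n) n"
      by (rule ab_eq.trans[OF ab_eq.add_commute ab_eq.add_zero] **)+
    then have "ab_class t = ab_class n"
      using **(5) ab_eq.trans ab_class_cong by metis
    then show ?thesis using ** by simp
  qed
qed

text \<open>
  The congruence axioms of \<open>ab_eq\<close> once more, now with well-typedness of the expressions
  involved as the only side condition.
\<close>

lemma
  shows
    eqv_add_assoc: "well_typed (s \<^bold>+ t \<^bold>+ u) \<Longrightarrow> s \<^bold>+ t \<^bold>+ u \<simeq> s \<^bold>+ (t \<^bold>+ u)"
  and eqv_add_commute: "well_typed (s \<^bold>+ t) \<Longrightarrow> s \<^bold>+ t \<simeq> t \<^bold>+ s"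
  and eqv_add_zero: "well_typed (t \<^bold>+ Zer a b) \<Longrightarrow> t \<^bold>+ Zer a b \<simeq> t"
  and eqv_scl_one: "well_typed t \<Longrightarrow> 1 \<^bold>* t \<simeq> t"
  and eqv_scl_scl: "well_typed t \<Longrightarrow> c \<^bold>* d \<^bold>* t \<simeq> (c * d) \<^bold>* t"
  and eqv_scl_add: "well_typed (s \<^bold>+ t) \<Longrightarrow> c \<^bold>* (s \<^bold>+ t) \<simeq> c \<^bold>* s \<^bold>+ c \<^bold>* t"
  and eqv_add_scl: "well_typed t \<Longrightarrow> (c + d) \<^bold>* t \<simeq> c \<^bold>* t \<^bold>+ d \<^bold>* t"
  and eqv_cmp_assoc: "well_typed (u \<^bold>\<cdot> t \<^bold>\<cdot> s) \<Longrightarrow> u \<^bold>\<cdot> t \<^bold>\<cdot> s \<simeq> u \<^bold>\<cdot> (t \<^bold>\<cdot> s)"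
  and eqv_id_cmp: "well_typed (Idm b \<^bold>\<cdot> t) \<Longrightarrow> Idm b \<^bold>\<cdot> t \<simeq> t"
  and eqv_cmp_id: "well_typed (t \<^bold>\<cdot> Idm b) \<Longrightarrow> t \<^bold>\<cdot> Idm b \<simeq> t"
  and eqv_cmp_add_left: "well_typed ((t \<^bold>+ t') \<^bold>\<cdot> s) \<Longrightarrow> (t \<^bold>+ t') \<^bold>\<cdot> s \<simeq> t \<^bold>\<cdot> s \<^bold>+ t' \<^bold>\<cdot> s"
  and eqv_cmp_add_right: "well_typed (t \<^bold>\<cdot> (s \<^bold>+ s')) \<Longrightarrow> t \<^bold>\<cdot> (s \<^bold>+ s') \<simeq> t \<^bold>\<cdot> s \<^bold>+ t \<^bold>\<cdot> s'"
  and eqv_cmp_scl_left: "well_typed (t \<^bold>\<cdot> s) \<Longrightarrow> (c \<^bold>* t) \<^bold>\<cdot> s \<simeq> c \<^bold>* (t \<^bold>\<cdot> s)"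
  and eqv_cmp_scl_right: "well_typed (t \<^bold>\<cdot> s) \<Longrightarrow> t \<^bold>\<cdot> (c \<^bold>* s) \<simeq> c \<^bold>* (t \<^bold>\<cdot> s)"
  and eqv_interchange: "well_typed (t \<^bold>\<cdot> s) \<Longrightarrow> well_typed (t' \<^bold>\<cdot> s') \<Longrightarrow> (t \<^bold>\<otimes> t') \<^bold>\<cdot> (s \<^bold>\<otimes> s') \<simeq> (t \<^bold>\<cdot> s) \<^bold>\<otimes> (t' \<^bold>\<cdot> s')"
  and eqv_tens_id: "Idm x \<^bold>\<otimes> Idm y \<simeq> Idm (x + y)"
  and eqv_tens_assoc: "well_typed s \<Longrightarrow> well_typed t \<Longrightarrow> well_typed u \<Longrightarrow> s \<^bold>\<otimes> t \<^bold>\<otimes> u \<simeq> s \<^bold>\<otimes> (t \<^bold>\<otimes> u)"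
  and eqv_unit_tens: "well_typed t \<Longrightarrow> Idm 0 \<^bold>\<otimes> t \<simeq> t"
  and eqv_tens_unit: "well_typed t \<Longrightarrow> t \<^bold>\<otimes> Idm 0 \<simeq> t"
  and eqv_tens_add_right: "well_typed s \<Longrightarrow> well_typed (t \<^bold>+ t') \<Longrightarrow> s \<^bold>\<otimes> (t \<^bold>+ t') \<simeq> s \<^bold>\<otimes> t \<^bold>+ s \<^bold>\<otimes> t'"
  and eqv_tens_scl_right: "well_typed s \<Longrightarrow> well_typed t \<Longrightarrow> s \<^bold>\<otimes> (c \<^bold>* t) \<simeq> c \<^bold>* (s \<^bold>\<otimes> t)"
  and eqv_add_neg: "well_typed t \<Longrightarrow> t \<^bold>+ (-1) \<^bold>* t \<simeq> Zer (fst (type_of t)) (snd (type_of t))"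
  by (rule eqv_of_ab_eq, rule ab_eq.intros; simp add: typed_iff prod_eq_iff; fail)+


lemma eqv_exchange:
  assumes "well_typed ((s \<^bold>+ t) \<^bold>+ (u \<^bold>+ v))"
  shows "(s \<^bold>+ t) \<^bold>+ (u \<^bold>+ v) \<simeq> (s \<^bold>+ u) \<^bold>+ (t \<^bold>+ v)"
  by (rule eqv_of_ab_eq[OF ab_eq_exchange[of _ "fst (type_of s)" "snd (type_of s)"]])
    (use assms in \<open>auto simp: typed_iff\<close>)

lemma eqv_zero_scl:
  assumes "typed t a b"
  shows "0 \<^bold>* t \<simeq> Zer a b"
proof -
  have "0 \<^bold>* t \<simeq> (1 + (-1)) \<^bold>* t"
    using assms by (simp add: eqv_refl typed_iff)
  also have "\<dots> \<simeq> 1 \<^bold>* t \<^bold>+ (-1) \<^bold>* t"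
    by (rule eqv_add_scl) (use assms in \<open>simp add: typed_iff\<close>)
  also have "\<dots> \<simeq> t \<^bold>+ (-1) \<^bold>* t"
    by (rule eqv_add_cong eqv_scl_one eqv_refl | use assms in \<open>simp add: typed_iff\<close>)+
  also have "\<dots> \<simeq> Zer a b"
    using eqv_add_neg[of t] assms by (simp add: typed_iff)
  finally show ?thesis .
qed

lemma eqv_scl_zero: "c \<^bold>* Zer a b \<simeq> Zer a b"
proof -
  have Z: "typed (Zer a b) a b" by (simp add: typed_iff)
  have "c \<^bold>* Zer a b \<simeq> c \<^bold>* 0 \<^bold>* Zer a b"
    by (rule eqv_scl_cong eqv_sym[OF eqv_zero_scl] Z | simp)+
  also have "\<dots> \<simeq> (c * 0) \<^bold>* Zer a b"
    by (rule eqv_scl_scl) simp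
  also have "\<dots> \<simeq> Zer a b"
    using eqv_zero_scl[OF Z] by simp
  finally show ?thesis .
qed

lemma eqv_cmp_zero:
  assumes "typed t b c"
  shows "t \<^bold>\<cdot> Zer a b \<simeq> Zer a c"
proof -
  have "t \<^bold>\<cdot> Zer a b \<simeq> t \<^bold>\<cdot> (0 \<^bold>* Zer a b)"
    by (rule eqv_cmp_cong eqv_refl eqv_sym[OF eqv_zero_scl] | use assms in \<open>simp add: typed_iff\<close>)+
  also have "\<dots> \<simeq> 0 \<^bold>* (t \<^bold>\<cdot> Zer a b)"
    by (rule eqv_cmp_scl_right) (use assms in \<open>simp_all add: typed_iff\<close>)
  also have "\<dots> \<simeq> Zer a c"
    by (rule eqv_zero_scl) (use assms in \<open>simp_all add: typed_iff\<close>)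
  finally show ?thesis .
qed

lemma eqv_zero_cmp:
  assumes "typed s a b"
  shows "Zer b c \<^bold>\<cdot> s \<simeq> Zer a c"
proof -
  have "Zer b c \<^bold>\<cdot> s \<simeq> (0 \<^bold>* Zer b c) \<^bold>\<cdot> s"
    by (rule eqv_cmp_cong eqv_refl eqv_sym[OF eqv_zero_scl] | use assms in \<open>simp add: typed_iff\<close>)+
  also have "\<dots> \<simeq> 0 \<^bold>* (Zer b c \<^bold>\<cdot> s)"
    by (rule eqv_cmp_scl_left) (use assms in \<open>simp_all add: typed_iff\<close>)
  also have "\<dots> \<simeq> Zer a c"
    by (rule eqv_zero_scl) (use assms in \<open>simp_all add: typed_iff\<close>)
  finally show ?thesis .
qed

lemma eqv_tens_zero: "Idm x \<^bold>\<otimes> Zer a b \<simeq> Zer (x + a) (x + b)"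
proof -
  have "Idm x \<^bold>\<otimes> Zer a b \<simeq> Idm x \<^bold>\<otimes> (0 \<^bold>* Zer a b)"
    by (rule eqv_tens_cong eqv_sym[OF eqv_zero_scl] | simp add: typed_iff)+
  also have "\<dots> \<simeq> 0 \<^bold>* (Idm x \<^bold>\<otimes> Zer a b)"
    by (rule eqv_tens_scl_right) simp_all
  also have "\<dots> \<simeq> Zer (x + a) (x + b)"
    by (rule eqv_zero_scl) (simp_all add: typed_iff)
  finally show ?thesis .
qed

lemma eqv_add_zero_left:
  assumes "typed t a b"
  shows "Zer a b \<^bold>+ t \<simeq> t"
  by (rule eqv_trans[OF eqv_add_commute eqv_add_zero]) (use assms in \<open>simp_all add: typed_iff\<close>)

lemma eqv_add_cancel:
  assumes "s \<^bold>+ t \<simeq> s \<^bold>+ u"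
  shows "t \<simeq> u"
proof -
  define a b where "a = fst (type_of s)" and "b = snd (type_of s)"
  then have ty: "typed s a b" "typed t a b" "typed u a b"
    using eqv_type[OF assms] by (auto simp: typed_iff prod_eq_iff)
  note wt = ty[unfolded typed_iff]
  have *: "(-1) \<^bold>* s \<^bold>+ (s \<^bold>+ v) \<simeq> v" if "typed v a b" for v
  proof -
    have "(-1) \<^bold>* s \<^bold>+ (s \<^bold>+ v) \<simeq> (-1) \<^bold>* s \<^bold>+ s \<^bold>+ v"
      by (rule eqv_sym[OF eqv_add_assoc]) (use wt that in \<open>simp add: typed_iff\<close>)
    also have "\<dots> \<simeq> s \<^bold>+ (-1) \<^bold>* s \<^bold>+ v"
      by (rule eqv_add_cong[OF eqv_add_commute eqv_refl] | use wt that in \<open>simp add: typed_iff\<close>)+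
    also have "\<dots> \<simeq> Zer a b \<^bold>+ v"
      using eqv_add_neg[of s] wt that
      by (intro eqv_add_cong eqv_refl) (simp_all add: typed_iff)
    also have "\<dots> \<simeq> v"
      by (rule eqv_add_zero_left that | simp)+
    finally show ?thesis .
  qed
  have "t \<simeq> (-1) \<^bold>* s \<^bold>+ (s \<^bold>+ t)"
    by (rule eqv_sym[OF *] ty | simp)+
  also have "\<dots> \<simeq> (-1) \<^bold>* s \<^bold>+ (s \<^bold>+ u)"
    by (rule eqv_add_cong assms eqv_refl | use wt in \<open>simp\<close>)+
  also have "\<dots> \<simeq> u"
    by (rule * ty | simp)+
  finally show ?thesis .
qed

end

section \<open>Polynomials in the dot\<close>

primrec term_sum :: "nat \<Rightarrow> nat \<Rightarrow> (nat \<Rightarrow> 'k ab_term) \<Rightarrow> nat \<Rightarrow> 'k ab_term" where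
  "term_sum a b f 0 = Zer a b"
| "term_sum a b f (Suc n) = term_sum a b f n \<^bold>+ f n"

lemma type_term_sum [simp]:
  assumes "\<And>i. i < n \<Longrightarrow> typed (f i) a b"
  shows "well_typed (term_sum a b f n)" "type_of (term_sum a b f n) = (a, b)"
  using assms by (induction n) (auto simp: typed_iff)

primrec dot_power :: "nat \<Rightarrow> 'k ab_term" where
  "dot_power 0 = Idm 1"
| "dot_power (Suc n) = Dot \<^bold>\<cdot> dot_power n"

lemma type_dot_power [simp]:
  "well_typed (dot_power n :: 'k ab_term)" "type_of (dot_power n :: 'k ab_term) = (Suc 0, Suc 0)"
  by (induction n) simp_all

text \<open>
  A polynomial in the dot truncated after \<open>n\<close> terms. Unlike \<open>dot_poly\<close>, whose number of terms is
  governed by the degree, this is visibly additive in \<open>q\<close> for fixed \<open>n\<close>.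
\<close>

definition dot_sum :: "nat \<Rightarrow> 'k::field poly \<Rightarrow> 'k ab_term" where
  "dot_sum n q = term_sum 1 1 (\<lambda>i. coeff q i \<^bold>* dot_power i) n"

definition dot_poly :: "'k::field poly \<Rightarrow> 'k ab_term" where
  "dot_poly q = dot_sum (Suc (degree q)) q"

lemma type_dot_sum [simp]:
  "well_typed (dot_sum n q)" "type_of (dot_sum n q) = (Suc 0, Suc 0)"
  by (simp_all add: dot_sum_def typed_iff)

lemma type_dot_poly [simp]:
  "well_typed (dot_poly q)" "type_of (dot_poly q) = (Suc 0, Suc 0)"
  by (simp_all add: dot_poly_def)

lemma dot_sum_Suc: "dot_sum (Suc n) q = dot_sum n q \<^bold>+ coeff q n \<^bold>* dot_power n"
  and dot_sum_0: "dot_sum 0 q = Zer 1 1"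
  by (simp_all add: dot_sum_def)

context left_ideal
begin

lemma dot_sum_eqv_dot_poly:
  assumes "degree q < n"
  shows "dot_sum n q \<simeq> dot_poly q"
proof -
  from assms have "Suc (degree q) \<le> n" by simp
  then show ?thesis
  proof (induction n rule: dec_induct)
    case base
    show ?case by (simp add: dot_poly_def eqv_refl)
  next
    case (step n)
    have "dot_sum (Suc n) q \<simeq> dot_sum n q \<^bold>+ Zer 1 1"
      unfolding dot_sum_Suc
      using step.hyps eqv_zero_scl[of "dot_power n" 1 1]
      by (intro eqv_add_cong eqv_refl) (simp_all add: coeff_eq_0 typed_iff)
    also have "\<dots> \<simeq> dot_sum n q"
      by (rule eqv_add_zero) simp
    finally show ?case using step.IH by (rule eqv_trans)
  qed
qed

lemma dot_poly_add: "dot_poly (q + r) \<simeq> dot_poly q \<^bold>+ dot_poly r"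
proof -
  have *: "dot_sum n (q + r) \<simeq> dot_sum n q \<^bold>+ dot_sum n r" for n
  proof (induction n)
    case 0
    show ?case
      unfolding dot_sum_0 by (rule eqv_sym[OF eqv_add_zero] | simp)+
  next
    case (Suc n)
    have "dot_sum (Suc n) (q + r)
        \<simeq> (dot_sum n q \<^bold>+ dot_sum n r) \<^bold>+ (coeff q n \<^bold>* dot_power n \<^bold>+ coeff r n \<^bold>* dot_power n)"
      unfolding dot_sum_Suc coeff_add by (rule eqv_add_cong Suc.IH eqv_add_scl | simp)+
    also have "\<dots> \<simeq> dot_sum (Suc n) q \<^bold>+ dot_sum (Suc n) r"
      unfolding dot_sum_Suc by (rule eqv_exchange) simp
    finally show ?case .
  qed
  let ?n = "Suc (max (degree (q + r)) (max (degree q) (degree r)))"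
  have "dot_poly (q + r) \<simeq> dot_sum ?n (q + r)"
    by (rule eqv_sym[OF dot_sum_eqv_dot_poly] | simp)+
  also note *[of ?n]
  also have "dot_sum ?n q \<^bold>+ dot_sum ?n r \<simeq> dot_poly q \<^bold>+ dot_poly r"
    by (rule eqv_add_cong dot_sum_eqv_dot_poly | simp)+
  finally show ?thesis .
qed

lemma dot_poly_smult: "dot_poly (smult c q) \<simeq> c \<^bold>* dot_poly q"
proof -
  have *: "dot_sum n (smult c q) \<simeq> c \<^bold>* dot_sum n q" for n
  proof (induction n)
    case 0
    show ?case
      unfolding dot_sum_0 by (rule eqv_sym[OF eqv_scl_zero] | simp)+
  next
    case (Suc n)
    have "dot_sum (Suc n) (smult c q) \<simeq> c \<^bold>* dot_sum n q \<^bold>+ c \<^bold>* coeff q n \<^bold>* dot_power n"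
      unfolding dot_sum_Suc coeff_smult
      by (rule eqv_add_cong Suc.IH eqv_sym[OF eqv_scl_scl] | simp)+
    also have "\<dots> \<simeq> c \<^bold>* dot_sum (Suc n) q"
      unfolding dot_sum_Suc by (rule eqv_sym[OF eqv_scl_add] | simp)+
    finally show ?case .
  qed
  let ?n = "Suc (max (degree (smult c q)) (degree q))"
  have "dot_poly (smult c q) \<simeq> dot_sum ?n (smult c q)"
    by (rule eqv_sym[OF dot_sum_eqv_dot_poly]) simp
  also note *[of ?n]
  also have "c \<^bold>* dot_sum ?n q \<simeq> c \<^bold>* dot_poly q"
    by (rule eqv_scl_cong dot_sum_eqv_dot_poly | simp)+
  finally show ?thesis .
qed

lemma dot_poly_0: "dot_poly 0 \<simeq> Zer 1 1"
proof -
  have "dot_poly 0 \<simeq> Zer 1 1 \<^bold>+ Zer 1 1"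
    using eqv_zero_scl[of "Idm 1" 1 1] eqv_refl[of "Zer 1 1"]
    by (auto simp: dot_poly_def dot_sum_def typed_iff intro!: eqv_add_cong)
  also have "\<dots> \<simeq> Zer 1 1" by (rule eqv_add_zero) simp
  finally show ?thesis .
qed

lemma dot_poly_1: "dot_poly 1 \<simeq> Idm 1"
proof -
  have "dot_poly 1 \<simeq> 1 \<^bold>* Idm 1"
    unfolding dot_poly_def dot_sum_def
    using eqv_add_zero_left[of "1 \<^bold>* Idm 1" 1 1] by (simp add: typed_iff)
  also have "\<dots> \<simeq> Idm 1" by (rule eqv_scl_one) simp
  finally show ?thesis .
qed

lemma dot_power_commute: "dot_power n \<^bold>\<cdot> Dot \<simeq> Dot \<^bold>\<cdot> dot_power n"
proof (induction n)
  case 0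
  have "Idm 1 \<^bold>\<cdot> Dot \<simeq> Dot" by (rule eqv_id_cmp) simp
  also have "Dot \<simeq> Dot \<^bold>\<cdot> Idm 1" by (rule eqv_sym[OF eqv_cmp_id]) simp
  finally show ?case by simp
next
  case (Suc n)
  have "dot_power (Suc n) \<^bold>\<cdot> Dot \<simeq> Dot \<^bold>\<cdot> (dot_power n \<^bold>\<cdot> Dot)"
    unfolding dot_power.simps by (rule eqv_cmp_assoc) simp
  also have "\<dots> \<simeq> Dot \<^bold>\<cdot> dot_power (Suc n)"
    unfolding dot_power.simps by (rule eqv_cmp_cong[OF eqv_refl Suc.IH]) simp_all
  finally show ?case .
qed

lemma dot_poly_commute: "dot_poly q \<^bold>\<cdot> Dot \<simeq> Dot \<^bold>\<cdot> dot_poly q"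
proof -
  have "dot_sum n q \<^bold>\<cdot> Dot \<simeq> Dot \<^bold>\<cdot> dot_sum n q" for n
  proof (induction n)
    case 0
    have "Zer 1 1 \<^bold>\<cdot> Dot \<simeq> Zer 1 1" by (rule eqv_zero_cmp) (simp add: typed_iff)
    also have "Zer 1 1 \<simeq> Dot \<^bold>\<cdot> Zer 1 1"
      by (rule eqv_sym[OF eqv_cmp_zero]) (simp add: typed_iff)
    finally show ?case by (simp add: dot_sum_0)
  next
    case (Suc n)
    have "dot_sum (Suc n) q \<^bold>\<cdot> Dot \<simeq> dot_sum n q \<^bold>\<cdot> Dot \<^bold>+ (coeff q n \<^bold>* dot_power n) \<^bold>\<cdot> Dot"
      unfolding dot_sum_Suc by (rule eqv_cmp_add_left) simp
    also have "\<dots> \<simeq> Dot \<^bold>\<cdot> dot_sum n q \<^bold>+ coeff q n \<^bold>* (dot_power n \<^bold>\<cdot> Dot)"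
      by (rule eqv_add_cong Suc.IH eqv_cmp_scl_left | simp)+
    also have "\<dots> \<simeq> Dot \<^bold>\<cdot> dot_sum n q \<^bold>+ coeff q n \<^bold>* (Dot \<^bold>\<cdot> dot_power n)"
      by (rule eqv_add_cong eqv_scl_cong dot_power_commute eqv_refl | simp)+
    also have "\<dots> \<simeq> Dot \<^bold>\<cdot> dot_sum n q \<^bold>+ Dot \<^bold>\<cdot> (coeff q n \<^bold>* dot_power n)"
      by (rule eqv_add_cong[OF eqv_refl eqv_sym[OF eqv_cmp_scl_right]]) simp_all
    also have "\<dots> \<simeq> Dot \<^bold>\<cdot> dot_sum (Suc n) q"
      unfolding dot_sum_Suc by (rule eqv_sym[OF eqv_cmp_add_right] | simp)+
    finally show ?case .
  qed
  then show ?thesis by (simp add: dot_poly_def)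
qed

lemma dot_poly_pCons_0: "dot_poly (pCons 0 q) \<simeq> Dot \<^bold>\<cdot> dot_poly q"
proof -
  have *: "dot_sum (Suc n) (pCons 0 q) \<simeq> Dot \<^bold>\<cdot> dot_sum n q" for n
  proof (induction n)
    case 0
    have "dot_sum 1 (pCons 0 q) \<simeq> Zer 1 1"
      using eqv_trans[OF eqv_add_zero_left[of "0 \<^bold>* Idm 1" 1 1] eqv_zero_scl[of "Idm 1" 1 1]]
      by (simp add: dot_sum_def typed_iff)
    also have "Zer 1 1 \<simeq> Dot \<^bold>\<cdot> Zer 1 1"
      by (rule eqv_sym[OF eqv_cmp_zero]) (simp add: typed_iff)
    finally show ?case by (simp add: dot_sum_0)
  next
    case (Suc n)
    have "dot_sum (Suc (Suc n)) (pCons 0 q) \<simeq> Dot \<^bold>\<cdot> dot_sum n q \<^bold>+ Dot \<^bold>\<cdot> (coeff q n \<^bold>* dot_power n)"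
      unfolding dot_sum_Suc[of "Suc n"] coeff_pCons_Suc dot_power.simps
      by (rule eqv_add_cong Suc.IH eqv_sym[OF eqv_cmp_scl_right] | simp)+
    also have "\<dots> \<simeq> Dot \<^bold>\<cdot> dot_sum (Suc n) q"
      unfolding dot_sum_Suc by (rule eqv_sym[OF eqv_cmp_add_right] | simp)+
    finally show ?case .
  qed
  have "dot_poly (pCons 0 q) \<simeq> dot_sum (Suc (Suc (degree q))) (pCons 0 q)"
    by (rule eqv_sym[OF dot_sum_eqv_dot_poly]) (simp add: degree_pCons_eq_if)
  also have "\<dots> \<simeq> Dot \<^bold>\<cdot> dot_poly q"
    unfolding dot_poly_def by (rule *)
  finally show ?thesis .
qed

lemma dot_poly_mult_eqv_zero:
  assumes "dot_poly q \<simeq> Zer 1 1"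
  shows "dot_poly (r * q) \<simeq> Zer 1 1"
proof (induction r)
  case 0
  show ?case using dot_poly_0 by simp
next
  case (pCons a r)
  have "dot_poly (pCons a r * q) \<simeq> dot_poly (smult a q) \<^bold>+ dot_poly (pCons 0 (r * q))"
    using dot_poly_add by simp
  also have "\<dots> \<simeq> a \<^bold>* dot_poly q \<^bold>+ Dot \<^bold>\<cdot> dot_poly (r * q)"
    by (rule eqv_add_cong dot_poly_smult dot_poly_pCons_0 | simp)+
  also have "\<dots> \<simeq> a \<^bold>* Zer 1 1 \<^bold>+ Dot \<^bold>\<cdot> Zer 1 1"
    by (rule eqv_add_cong eqv_scl_cong eqv_cmp_cong eqv_refl pCons.IH assms | simp)+
  also have "\<dots> \<simeq> Zer 1 1 \<^bold>+ Zer 1 1"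
    by (rule eqv_add_cong eqv_scl_zero eqv_cmp_zero | simp add: typed_iff)+
  also have "\<dots> \<simeq> Zer 1 1"
    by (rule eqv_add_zero) simp
  finally show ?case .
qed


text \<open>
  Dots are put on the right strand of the cap, because \<open>I \<otimes> q(x)\<close> is in \<open>J\<close> as soon as \<open>q(x)\<close> is.
\<close>

definition cap_poly :: "'k poly \<Rightarrow> 'k ab_term" where
  "cap_poly q = Cap \<^bold>\<cdot> (\<^bold>I \<^bold>\<otimes> dot_poly q)"

text \<open>
  The closure of an endomorphism of one strand to an endomorphism of the unit object; the returning
  strand is on the left, which makes the closure well defined modulo \<open>J\<close>.
\<close>

definition closure :: "'k ab_term \<Rightarrow> 'k ab_term" where
  "closure t = Cap \<^bold>\<cdot> (\<^bold>I \<^bold>\<otimes> t) \<^bold>\<cdot> Cup"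

lemma type_cap_poly [simp]: "well_typed (cap_poly q)" "type_of (cap_poly q) = (2, 0)"
  by (simp_all add: cap_poly_def)

lemma eqv_cap_poly:
  assumes "dot_poly q \<simeq> t"
  shows "cap_poly q \<simeq> Cap \<^bold>\<cdot> (\<^bold>I \<^bold>\<otimes> t)"
  unfolding cap_poly_def by (rule eqv_cmp_cong[OF eqv_refl eqv_tens_cong[OF assms]]) simp_all

lemma cap_poly_add: "cap_poly (q + r) \<simeq> cap_poly q \<^bold>+ cap_poly r"
proof -
  have "cap_poly (q + r) \<simeq> Cap \<^bold>\<cdot> (\<^bold>I \<^bold>\<otimes> (dot_poly q \<^bold>+ dot_poly r))"
    by (rule eqv_cap_poly[OF dot_poly_add])
  also have "\<dots> \<simeq> Cap \<^bold>\<cdot> (\<^bold>I \<^bold>\<otimes> dot_poly q \<^bold>+ \<^bold>I \<^bold>\<otimes> dot_poly r)"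
    by (rule eqv_cmp_cong[OF eqv_refl eqv_tens_add_right]) simp_all
  also have "\<dots> \<simeq> cap_poly q \<^bold>+ cap_poly r"
    unfolding cap_poly_def by (rule eqv_cmp_add_right) simp
  finally show ?thesis .
qed

lemma cap_poly_smult: "cap_poly (smult c q) \<simeq> c \<^bold>* cap_poly q"
proof -
  have "cap_poly (smult c q) \<simeq> Cap \<^bold>\<cdot> (\<^bold>I \<^bold>\<otimes> (c \<^bold>* dot_poly q))"
    by (rule eqv_cap_poly[OF dot_poly_smult])
  also have "\<dots> \<simeq> Cap \<^bold>\<cdot> (c \<^bold>* (\<^bold>I \<^bold>\<otimes> dot_poly q))"
    by (rule eqv_cmp_cong[OF eqv_refl eqv_tens_scl_right]) simp_all
  also have "\<dots> \<simeq> c \<^bold>* cap_poly q"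
    unfolding cap_poly_def by (rule eqv_cmp_scl_right) simp
  finally show ?thesis .
qed

lemma cap_poly_zero:
  assumes "dot_poly q \<simeq> Zer 1 1"
  shows "cap_poly q \<simeq> Zer 2 0"
proof -
  have "cap_poly q \<simeq> Cap \<^bold>\<cdot> (\<^bold>I \<^bold>\<otimes> Zer 1 1)"
    by (rule eqv_cap_poly[OF assms])
  also have "\<dots> \<simeq> Cap \<^bold>\<cdot> Zer (1 + 1) (1 + 1)"
    by (rule eqv_cmp_cong[OF eqv_refl eqv_tens_zero]) simp_all
  also have "\<dots> \<simeq> Zer (1 + 1) 0"
    by (rule eqv_cmp_zero) (simp add: typed_iff)
  finally show ?thesis by (simp add: numeral_2_eq_2)
qed

lemma cap_poly_1: "cap_poly 1 \<simeq> Cap"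
proof -
  have "cap_poly 1 \<simeq> Cap \<^bold>\<cdot> (\<^bold>I \<^bold>\<otimes> \<^bold>I)"
    by (rule eqv_cap_poly[OF dot_poly_1])
  also have "\<dots> \<simeq> Cap \<^bold>\<cdot> Idm (1 + 1)"
    by (rule eqv_cmp_cong[OF eqv_refl eqv_tens_id]) simp_all
  also have "\<dots> \<simeq> Cap"
    by (rule eqv_cmp_id) simp
  finally show ?thesis .
qed

lemma eqv_tens_cmp:
  assumes "well_typed (t \<^bold>\<cdot> s)"
  shows "Idm x \<^bold>\<otimes> (t \<^bold>\<cdot> s) \<simeq> (Idm x \<^bold>\<otimes> t) \<^bold>\<cdot> (Idm x \<^bold>\<otimes> s)"
proof -
  obtain a b c where ty: "typed t b c" "typed s a b"
    using assms by (cases "type_of s"; cases "type_of t") (auto simp: typed_iff)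
  have id: "typed (Idm x) x x" by (simp add: typed_iff)
  show ?thesis
    by (rule eqv_sym[OF eqv_of_ab_eq], rule ab_eq.trans[OF ab_eq.interchange ab_eq.tens_cong])
      (rule id ty ab_eq.id_cmp ab_eq.refl[OF typed.intros(9)])+
qed

lemma cap_poly_append_dot: "cap_poly q \<^bold>\<cdot> (\<^bold>I \<^bold>\<otimes> Dot) \<simeq> cap_poly (pCons 0 q)"
proof -
  have "cap_poly q \<^bold>\<cdot> (\<^bold>I \<^bold>\<otimes> Dot) \<simeq> Cap \<^bold>\<cdot> ((\<^bold>I \<^bold>\<otimes> dot_poly q) \<^bold>\<cdot> (\<^bold>I \<^bold>\<otimes> Dot))"
    unfolding cap_poly_def by (rule eqv_cmp_assoc) simp
  also have "\<dots> \<simeq> Cap \<^bold>\<cdot> (\<^bold>I \<^bold>\<otimes> (dot_poly q \<^bold>\<cdot> Dot))"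
    by (rule eqv_cmp_cong[OF eqv_refl eqv_sym[OF eqv_tens_cmp]]) simp_all
  also have "\<dots> \<simeq> cap_poly (pCons 0 q)"
    by (rule eqv_sym[OF eqv_cap_poly], rule eqv_trans[OF dot_poly_pCons_0 eqv_sym[OF dot_poly_commute]])
  finally show ?thesis .
qed

lemma eqv_ab_relation:
  assumes "ab_relation s t" "well_typed s" "well_typed t" "type_of s = type_of t"
  shows "s \<simeq> t"
  using assms by (intro eqv_of_ab_eq[OF ab_eq.relation[of s t "fst (type_of s)" "snd (type_of s)"]])
    (auto simp: typed_iff)

text \<open>
  A dot on the right end of the cap slides over to the left end with a sign, and commutes there
  with the remaining dots on the right strand.
\<close>

lemma cap_poly_slide_dot: "cap_poly (pCons 0 q) \<simeq> (-1) \<^bold>* (cap_poly q \<^bold>\<cdot> (Dot \<^bold>\<otimes> \<^bold>I))"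
proof -
  have slide: "Cap \<^bold>\<cdot> (\<^bold>I \<^bold>\<otimes> Dot) \<simeq> (-1) \<^bold>* (Cap \<^bold>\<cdot> (Dot \<^bold>\<otimes> \<^bold>I))"
  proof -
    have "Cap \<^bold>\<cdot> (\<^bold>I \<^bold>\<otimes> Dot) \<simeq> 1 \<^bold>* (Cap \<^bold>\<cdot> (\<^bold>I \<^bold>\<otimes> Dot))"
      by (rule eqv_sym[OF eqv_scl_one]) simp
    also have "\<dots> = ((-1) * (-1)) \<^bold>* (Cap \<^bold>\<cdot> (\<^bold>I \<^bold>\<otimes> Dot))"
      by simp
    also have "\<dots> \<simeq> (-1) \<^bold>* (-1) \<^bold>* (Cap \<^bold>\<cdot> (\<^bold>I \<^bold>\<otimes> Dot))"
      by (rule eqv_sym[OF eqv_scl_scl]) simp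
    also have "\<dots> \<simeq> (-1) \<^bold>* (Cap \<^bold>\<cdot> (Dot \<^bold>\<otimes> \<^bold>I))"
      by (rule eqv_scl_cong[OF eqv_sym[OF eqv_ab_relation[OF ab_relation.intros(8)]]]) simp_all
    finally show ?thesis .
  qed
  have comm: "(Dot \<^bold>\<otimes> \<^bold>I) \<^bold>\<cdot> (\<^bold>I \<^bold>\<otimes> dot_poly q) \<simeq> (\<^bold>I \<^bold>\<otimes> dot_poly q) \<^bold>\<cdot> (Dot \<^bold>\<otimes> \<^bold>I)"
  proof (rule eqv_trans[OF _ eqv_sym])
    have ty: "typed Dot 1 1" "typed (dot_poly q) 1 1" by (simp_all add: typed_iff)
    show "(Dot \<^bold>\<otimes> \<^bold>I) \<^bold>\<cdot> (\<^bold>I \<^bold>\<otimes> dot_poly q) \<simeq> Dot \<^bold>\<otimes> dot_poly q"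
      by (rule eqv_of_ab_eq, rule ab_eq.trans[OF ab_eq.interchange ab_eq.tens_cong])
        (rule ty typed.intros ab_eq.cmp_id ab_eq.id_cmp)+
    show "(\<^bold>I \<^bold>\<otimes> dot_poly q) \<^bold>\<cdot> (Dot \<^bold>\<otimes> \<^bold>I) \<simeq> Dot \<^bold>\<otimes> dot_poly q"
      by (rule eqv_of_ab_eq, rule ab_eq.trans[OF ab_eq.interchange ab_eq.tens_cong])
        (rule ty typed.intros ab_eq.cmp_id ab_eq.id_cmp)+
  qed
  have "cap_poly (pCons 0 q) \<simeq> Cap \<^bold>\<cdot> (\<^bold>I \<^bold>\<otimes> (Dot \<^bold>\<cdot> dot_poly q))"
    by (rule eqv_cap_poly[OF dot_poly_pCons_0])
  also have "\<dots> \<simeq> Cap \<^bold>\<cdot> ((\<^bold>I \<^bold>\<otimes> Dot) \<^bold>\<cdot> (\<^bold>I \<^bold>\<otimes> dot_poly q))"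
    by (rule eqv_cmp_cong[OF eqv_refl eqv_tens_cmp]) simp_all
  also have "\<dots> \<simeq> Cap \<^bold>\<cdot> (\<^bold>I \<^bold>\<otimes> Dot) \<^bold>\<cdot> (\<^bold>I \<^bold>\<otimes> dot_poly q)"
    by (rule eqv_sym[OF eqv_cmp_assoc]) simp
  also have "\<dots> \<simeq> ((-1) \<^bold>* (Cap \<^bold>\<cdot> (Dot \<^bold>\<otimes> \<^bold>I))) \<^bold>\<cdot> (\<^bold>I \<^bold>\<otimes> dot_poly q)"
    by (rule eqv_cmp_cong[OF slide eqv_refl]) simp_all
  also have "\<dots> \<simeq> (-1) \<^bold>* (Cap \<^bold>\<cdot> (Dot \<^bold>\<otimes> \<^bold>I) \<^bold>\<cdot> (\<^bold>I \<^bold>\<otimes> dot_poly q))"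
    by (rule eqv_cmp_scl_left) simp
  also have "\<dots> \<simeq> (-1) \<^bold>* (Cap \<^bold>\<cdot> ((Dot \<^bold>\<otimes> \<^bold>I) \<^bold>\<cdot> (\<^bold>I \<^bold>\<otimes> dot_poly q)))"
    by (rule eqv_scl_cong[OF eqv_cmp_assoc]) simp
  also have "\<dots> \<simeq> (-1) \<^bold>* (Cap \<^bold>\<cdot> ((\<^bold>I \<^bold>\<otimes> dot_poly q) \<^bold>\<cdot> (Dot \<^bold>\<otimes> \<^bold>I)))"
    by (rule eqv_scl_cong[OF eqv_cmp_cong[OF eqv_refl comm]]) simp_all
  also have "\<dots> \<simeq> (-1) \<^bold>* (cap_poly q \<^bold>\<cdot> (Dot \<^bold>\<otimes> \<^bold>I))"
    unfolding cap_poly_def by (rule eqv_scl_cong[OF eqv_sym[OF eqv_cmp_assoc]]) simp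
  finally show ?thesis .
qed

text \<open>
  The strand with \<open>q(x)\<close> is recovered from \<open>c(q) = cap (I \<otimes> q(x))\<close> by joining a cup to the left leg of
  the cap (zigzag relation). The bending adds a strand on the left only, so it preserves \<open>J\<close>.
\<close>

lemma dot_poly_eqv_zero_if_cap_poly:
  assumes "cap_poly q \<simeq> Zer 2 0"
  shows "dot_poly q \<simeq> Zer 1 1"
proof -
  have ty: "typed (dot_poly q) 1 1" "typed Cup 0 2" "typed (Idm 2) 2 2" "typed (Idm 0) 0 0"
    "typed (Idm 1) 1 1"
    by (simp_all add: typed_iff)
  have "Idm 2 \<^bold>\<otimes> dot_poly q \<^bold>\<cdot> (Cup \<^bold>\<otimes> \<^bold>I) \<simeq> Cup \<^bold>\<otimes> dot_poly q"
    by (rule eqv_of_ab_eq, rule ab_eq.trans[OF ab_eq.interchange ab_eq.tens_cong])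
      (rule ty ab_eq.cmp_id ab_eq.id_cmp)+
  also have "Cup \<^bold>\<otimes> dot_poly q \<simeq> Cup \<^bold>\<otimes> \<^bold>I \<^bold>\<cdot> (Idm 0 \<^bold>\<otimes> dot_poly q)"
    by (rule eqv_sym[OF eqv_of_ab_eq], rule ab_eq.trans[OF ab_eq.interchange ab_eq.tens_cong])
      (rule ty ab_eq.cmp_id ab_eq.id_cmp)+
  also have "\<dots> \<simeq> Cup \<^bold>\<otimes> \<^bold>I \<^bold>\<cdot> dot_poly q"
    by (rule eqv_cmp_cong[OF eqv_refl eqv_unit_tens]) simp_all
  finally have past_cup: "Idm 2 \<^bold>\<otimes> dot_poly q \<^bold>\<cdot> (Cup \<^bold>\<otimes> \<^bold>I) \<simeq> Cup \<^bold>\<otimes> \<^bold>I \<^bold>\<cdot> dot_poly q" .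
  have "\<^bold>I \<^bold>\<otimes> (\<^bold>I \<^bold>\<otimes> dot_poly q) \<simeq> \<^bold>I \<^bold>\<otimes> \<^bold>I \<^bold>\<otimes> dot_poly q"
    by (rule eqv_sym[OF eqv_tens_assoc]) simp_all
  also have "\<dots> \<simeq> Idm (1 + 1) \<^bold>\<otimes> dot_poly q"
    by (rule eqv_of_ab_eq, rule ab_eq.tens_cong[OF ab_eq.tens_id ab_eq.refl], rule ty)
  finally have two: "\<^bold>I \<^bold>\<otimes> (\<^bold>I \<^bold>\<otimes> dot_poly q) \<simeq> Idm 2 \<^bold>\<otimes> dot_poly q"
    by (simp add: numeral_2_eq_2)
  have "dot_poly q \<simeq> \<^bold>I \<^bold>\<cdot> dot_poly q"
    by (rule eqv_sym[OF eqv_id_cmp]) simp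
  also have "\<dots> \<simeq> \<^bold>I \<^bold>\<otimes> Cap \<^bold>\<cdot> (Cup \<^bold>\<otimes> \<^bold>I) \<^bold>\<cdot> dot_poly q"
    by (rule eqv_cmp_cong[OF eqv_sym[OF eqv_ab_relation[OF ab_relation.intros(3)]] eqv_refl]) simp_all
  also have "\<dots> \<simeq> \<^bold>I \<^bold>\<otimes> Cap \<^bold>\<cdot> (Cup \<^bold>\<otimes> \<^bold>I \<^bold>\<cdot> dot_poly q)"
    by (rule eqv_cmp_assoc) simp
  also have "\<dots> \<simeq> \<^bold>I \<^bold>\<otimes> Cap \<^bold>\<cdot> (\<^bold>I \<^bold>\<otimes> (\<^bold>I \<^bold>\<otimes> dot_poly q) \<^bold>\<cdot> (Cup \<^bold>\<otimes> \<^bold>I))"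
    by (rule eqv_cmp_cong[OF eqv_refl eqv_trans[OF eqv_sym[OF past_cup]
          eqv_cmp_cong[OF eqv_sym[OF two] eqv_refl]]]) simp_all
  also have "\<dots> \<simeq> \<^bold>I \<^bold>\<otimes> Cap \<^bold>\<cdot> (\<^bold>I \<^bold>\<otimes> (\<^bold>I \<^bold>\<otimes> dot_poly q)) \<^bold>\<cdot> (Cup \<^bold>\<otimes> \<^bold>I)"
    by (rule eqv_sym[OF eqv_cmp_assoc]) simp
  also have "\<dots> \<simeq> \<^bold>I \<^bold>\<otimes> cap_poly q \<^bold>\<cdot> (Cup \<^bold>\<otimes> \<^bold>I)"
    unfolding cap_poly_def by (rule eqv_cmp_cong[OF eqv_sym[OF eqv_tens_cmp] eqv_refl]) simp_all
  also have "\<dots> \<simeq> Zer (1 + 2) (1 + 0) \<^bold>\<cdot> (Cup \<^bold>\<otimes> \<^bold>I)"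
    by (rule eqv_cmp_cong[OF eqv_trans[OF eqv_tens_cong[OF assms] eqv_tens_zero] eqv_refl]) simp_all
  also have "\<dots> \<simeq> Zer 1 (1 + 0)"
    by (rule eqv_zero_cmp) (simp add: typed_iff)
  finally show ?thesis by simp
qed

lemma type_closure [simp]:
  "well_typed (closure t) \<longleftrightarrow> well_typed t \<and> type_of t = (1, 1)"
  "type_of (closure t) = (0, 0)"
  by (auto simp: closure_def prod_eq_iff)

lemma closure_cong:
  assumes "s \<simeq> t" "type_of s = (1, 1)"
  shows "closure s \<simeq> closure t"
proof -
  have "well_typed s" using eqv_type[OF assms(1)] by blast
  then show ?thesis
    unfolding closure_def using assms
    by (intro eqv_cmp_cong eqv_refl eqv_tens_cong) simp_all
qed

lemma closure_add:
  assumes "well_typed (s \<^bold>+ t)" "type_of s = (1, 1)"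
  shows "closure (s \<^bold>+ t) \<simeq> closure s \<^bold>+ closure t"
proof -
  note wt = assms assms(1)[simplified]
  have ty: "type_of t = (1, 1)" using assms by simp
  have "closure (s \<^bold>+ t) \<simeq> Cap \<^bold>\<cdot> (\<^bold>I \<^bold>\<otimes> s \<^bold>+ \<^bold>I \<^bold>\<otimes> t) \<^bold>\<cdot> Cup"
    unfolding closure_def using wt ty
    by (intro eqv_cmp_cong eqv_refl eqv_tens_add_right) simp_all
  also have "\<dots> \<simeq> (Cap \<^bold>\<cdot> (\<^bold>I \<^bold>\<otimes> s) \<^bold>+ Cap \<^bold>\<cdot> (\<^bold>I \<^bold>\<otimes> t)) \<^bold>\<cdot> Cup"
    using wt ty by (intro eqv_cmp_cong eqv_refl eqv_cmp_add_right) simp_all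
  also have "\<dots> \<simeq> closure s \<^bold>+ closure t"
    unfolding closure_def using wt ty by (intro eqv_cmp_add_left) simp_all
  finally show ?thesis .
qed

lemma closure_scl:
  assumes "well_typed t" "type_of t = (1, 1)"
  shows "closure (c \<^bold>* t) \<simeq> c \<^bold>* closure t"
proof -
  have "closure (c \<^bold>* t) \<simeq> Cap \<^bold>\<cdot> (c \<^bold>* (\<^bold>I \<^bold>\<otimes> t)) \<^bold>\<cdot> Cup"
    unfolding closure_def using assms
    by (intro eqv_cmp_cong eqv_refl eqv_tens_scl_right) simp_all
  also have "\<dots> \<simeq> (c \<^bold>* (Cap \<^bold>\<cdot> (\<^bold>I \<^bold>\<otimes> t))) \<^bold>\<cdot> Cup"
    using assms by (intro eqv_cmp_cong eqv_refl eqv_cmp_scl_right) simp_all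
  also have "\<dots> \<simeq> c \<^bold>* closure t"
    unfolding closure_def using assms by (intro eqv_cmp_scl_left) simp_all
  finally show ?thesis .
qed

end

section \<open>Scalar bubbles\<close>

text \<open>
  The value at \<open>u\<^sup>n q(u)\<close> of the linear functional \<open>u\<^sup>i \<mapsto> b i\<close>. If \<open>b i\<close> is the value of the bubble
  with \<open>i\<close> dots, this is the bubble decorated by \<open>x\<^sup>n q(x)\<close>.
\<close>

definition moment :: "(nat \<Rightarrow> 'k::field) \<Rightarrow> 'k poly \<Rightarrow> nat \<Rightarrow> 'k" where
  "moment b q n = (\<Sum>i\<le>degree q. coeff q i * b (n + i))"

lemma moment_eq_sum:
  assumes "degree q < N"
  shows "moment b q n = (\<Sum>i<N. coeff q i * b (n + i))"
  unfolding moment_def by (rule sum.mono_neutral_left) (use assms in \<open>auto simp: coeff_eq_0\<close>)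

lemma moment_0 [simp]: "moment b 0 n = 0"
  by (simp add: moment_def)

lemma moment_pCons [simp]: "moment b (pCons a q) n = a * b n + moment b q (Suc n)"
proof -
  have "moment b (pCons a q) n = (\<Sum>i<Suc (Suc (degree q)). coeff (pCons a q) i * b (n + i))"
    by (rule moment_eq_sum) (simp add: degree_pCons_eq_if)
  also have "\<dots> = a * b n + (\<Sum>i<Suc (degree q). coeff q i * b (Suc n + i))"
    by (subst sum.lessThan_Suc_shift) simp
  also have "(\<Sum>i<Suc (degree q). coeff q i * b (Suc n + i)) = moment b q (Suc n)"
    by (rule moment_eq_sum[symmetric]) simp
  finally show ?thesis .
qed

lemma moment_monom_mult: "moment b (monom 1 n * q) k = moment b q (k + n)"
  by (induction n arbitrary: k) (simp_all add: monom_Suc)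

text \<open>
  The polynomial \<open>q'\<close> with \<open>cap (I \<otimes> q(x)) s = cap (I \<otimes> q'(x))\<close>, by recursion on the coefficients of \<open>q\<close>:
  passing to \<open>u q\<close> moves one more dot over the cap, which changes the sign, and through the crossing,
  which adds the correction terms of the dot-crossing relation.
\<close>

primrec curl_list :: "(nat \<Rightarrow> 'k::field) \<Rightarrow> 'k list \<Rightarrow> 'k poly" where
  "curl_list b [] = 0"
| "curl_list b (a # as) =
    [:a + moment b (Poly as) 0:] - Poly as - pCons 0 (curl_list b as)"

definition curl :: "(nat \<Rightarrow> 'k::field) \<Rightarrow> 'k poly \<Rightarrow> 'k poly" where
  "curl b q = curl_list b (coeffs q)"

lemma curl_0 [simp]: "curl b 0 = 0"
  by (simp add: curl_def)

lemma curl_pCons [simp]: "curl b (pCons a q) = [:a + moment b q 0:] - q - pCons 0 (curl b q)"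
  by (simp add: curl_def cCons_def)

text \<open>
  Each dot contributes a sign when it slides over the cap, and all correction terms have lower
  degree. So in degrees from \<open>deg q\<close> on, the curl agrees with \<open>q(-u)\<close>.
\<close>

lemma coeff_curl: "degree q \<le> n \<Longrightarrow> coeff (curl b q) n = (-1) ^ n * coeff q n"
proof (induction q arbitrary: n)
  case 0
  show ?case by simp
next
  case (pCons a q)
  show ?case
  proof (cases n)
    case 0
    then have "q = 0" using pCons.prems by (auto simp: degree_pCons_eq_if split: if_splits)
    then show ?thesis using 0 by simp
  next
    case (Suc k)
    then have "degree q \<le> k"
      using pCons.prems by (auto simp: degree_pCons_eq_if split: if_splits)
    then show ?thesis
      using Suc pCons.IH[of k] by (simp add: coeff_eq_0 coeff_pCons)
  qed
qed

locale scalar_bubbles = left_ideal J for J :: "nat \<Rightarrow> nat \<Rightarrow> 'k::field ab_term set set" +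
  fixes b :: "nat \<Rightarrow> 'k"
  assumes bubble_eqv: "closure (dot_power n) \<simeq> b n \<^bold>* Idm 0"
begin

lemma closure_dot_poly: "closure (dot_poly q) \<simeq> moment b q 0 \<^bold>* Idm 0"
proof -
  have "closure (dot_sum n q) \<simeq> (\<Sum>i<n. coeff q i * b i) \<^bold>* Idm 0" for n
  proof (induction n)
    case 0
    have ty: "typed (Idm 1) 1 1" "typed (closure (Idm 1)) 0 0" "typed (Idm 0) 0 0"
      by (auto simp: typed_iff)
    have "closure (Zer 1 1) \<simeq> closure (0 \<^bold>* Idm 1)"
      by (rule closure_cong[OF eqv_sym[OF eqv_zero_scl[OF ty(1)]]]) simp
    also have "\<dots> \<simeq> 0 \<^bold>* closure (Idm 1)"
      by (rule closure_scl) simp_all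
    also have "\<dots> \<simeq> Zer 0 0"
      by (rule eqv_zero_scl[OF ty(2)])
    also have "\<dots> \<simeq> 0 \<^bold>* Idm 0"
      by (rule eqv_sym[OF eqv_zero_scl[OF ty(3)]])
    finally show ?case by (simp add: dot_sum_0)
  next
    case (Suc n)
    have "closure (dot_sum (Suc n) q) \<simeq> closure (dot_sum n q) \<^bold>+ closure (coeff q n \<^bold>* dot_power n)"
      unfolding dot_sum_Suc by (rule closure_add) simp_all
    also have "\<dots> \<simeq> closure (dot_sum n q) \<^bold>+ coeff q n \<^bold>* closure (dot_power n)"
      by (rule eqv_add_cong[OF eqv_refl closure_scl]) simp_all
    also have "\<dots> \<simeq> (\<Sum>i<n. coeff q i * b i) \<^bold>* Idm 0 \<^bold>+ coeff q n \<^bold>* b n \<^bold>* Idm 0"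
      by (rule eqv_add_cong[OF Suc.IH eqv_scl_cong[OF bubble_eqv]]) simp
    also have "\<dots> \<simeq> (\<Sum>i<n. coeff q i * b i) \<^bold>* Idm 0 \<^bold>+ (coeff q n * b n) \<^bold>* Idm 0"
      by (rule eqv_add_cong[OF eqv_refl eqv_scl_scl]) simp_all
    also have "\<dots> \<simeq> (\<Sum>i<Suc n. coeff q i * b i) \<^bold>* Idm 0"
      unfolding sum.lessThan_Suc by (rule eqv_sym[OF eqv_add_scl]) simp
    finally show ?case .
  qed
  from this[of "Suc (degree q)"] show ?thesis
    by (simp only: dot_poly_def moment_def add_0 lessThan_Suc_atMost)
qed

text \<open>
  Write \<open>c(q) = cap (I \<otimes> q(x))\<close>. Since \<open>c(u q) = - c(q) (x \<otimes> I)\<close> and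
  \<open>(x \<otimes> I) s = s (I \<otimes> x) + 1 - cup cap\<close>, induction gives
  \<open>c(u q) s = - c(q') (I \<otimes> x) - c(q) + c(q) cup cap\<close>. Here \<open>c(q) cup\<close> is the bubble decorated by \<open>q(x)\<close>,
  a scalar, and \<open>c(q') (I \<otimes> x) = c(u q')\<close>.
\<close>

theorem cap_poly_swap: "cap_poly q \<^bold>\<cdot> Swap \<simeq> cap_poly (curl b q)"
proof (induction q)
  case 0
  have z: "cap_poly 0 \<simeq> Zer 2 0"
    by (rule cap_poly_zero[OF dot_poly_0])
  have "cap_poly 0 \<^bold>\<cdot> Swap \<simeq> Zer 2 0 \<^bold>\<cdot> Swap"
    by (rule eqv_cmp_cong[OF z eqv_refl]) simp_all
  also have "\<dots> \<simeq> Zer 2 0" by (rule eqv_zero_cmp) (simp add: typed_iff)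
  also have "\<dots> \<simeq> cap_poly 0" by (rule eqv_sym[OF z])
  finally show ?case by simp
next
  case (pCons a q)
  let ?D = "Dot \<^bold>\<otimes> \<^bold>I" and ?D' = "\<^bold>I \<^bold>\<otimes> Dot" and ?h = "curl b q" and ?\<beta> = "moment b q 0"
  have dot_swap: "?D \<^bold>\<cdot> Swap \<simeq> Swap \<^bold>\<cdot> ?D' \<^bold>+ (Idm 2 \<^bold>+ (-1) \<^bold>* (Cup \<^bold>\<cdot> Cap))"
  proof (rule eqv_add_cancel[of "(-1) \<^bold>* (Swap \<^bold>\<cdot> ?D')"])
    let ?u = "Swap \<^bold>\<cdot> ?D'" and ?r = "Idm 2 \<^bold>+ (-1) \<^bold>* (Cup \<^bold>\<cdot> Cap)"
    have "(-1) \<^bold>* ?u \<^bold>+ ?D \<^bold>\<cdot> Swap \<simeq> ?D \<^bold>\<cdot> Swap \<^bold>+ (-1) \<^bold>* ?u"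
      by (rule eqv_add_commute) simp
    also have "\<dots> \<simeq> ?r"
      by (rule eqv_ab_relation[OF ab_relation.intros(7)]) simp_all
    also have "\<dots> \<simeq> Zer 2 2 \<^bold>+ ?r"
      by (rule eqv_sym[OF eqv_add_zero_left]) (simp add: typed_iff)
    also have "\<dots> \<simeq> (?u \<^bold>+ (-1) \<^bold>* ?u) \<^bold>+ ?r"
      using eqv_sym[OF eqv_add_neg[of ?u]]
      by (intro eqv_add_cong eqv_refl) (simp_all add: numeral_2_eq_2)
    also have "\<dots> \<simeq> ((-1) \<^bold>* ?u \<^bold>+ ?u) \<^bold>+ ?r"
      by (rule eqv_add_cong[OF eqv_add_commute eqv_refl]) simp_all
    also have "\<dots> \<simeq> (-1) \<^bold>* ?u \<^bold>+ (?u \<^bold>+ ?r)"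
      by (rule eqv_add_assoc) simp
    finally show "(-1) \<^bold>* ?u \<^bold>+ ?D \<^bold>\<cdot> Swap \<simeq> (-1) \<^bold>* ?u \<^bold>+ (?u \<^bold>+ ?r)" .
  qed
  have swap_part: "cap_poly q \<^bold>\<cdot> (Swap \<^bold>\<cdot> ?D') \<simeq> cap_poly (pCons 0 ?h)"
  proof -
    have "cap_poly q \<^bold>\<cdot> (Swap \<^bold>\<cdot> ?D') \<simeq> cap_poly q \<^bold>\<cdot> Swap \<^bold>\<cdot> ?D'"
      by (rule eqv_sym[OF eqv_cmp_assoc]) simp
    also have "\<dots> \<simeq> cap_poly ?h \<^bold>\<cdot> ?D'"
      by (rule eqv_cmp_cong[OF pCons.IH eqv_refl]) simp_all
    also have "\<dots> \<simeq> cap_poly (pCons 0 ?h)"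
      by (rule cap_poly_append_dot)
    finally show ?thesis .
  qed
  have turn_part: "cap_poly q \<^bold>\<cdot> (Cup \<^bold>\<cdot> Cap) \<simeq> cap_poly [:?\<beta>:]"
  proof -
    have "cap_poly q \<^bold>\<cdot> (Cup \<^bold>\<cdot> Cap) \<simeq> closure (dot_poly q) \<^bold>\<cdot> Cap"
      unfolding cap_poly_def closure_def by (rule eqv_sym[OF eqv_cmp_assoc]) simp
    also have "\<dots> \<simeq> (?\<beta> \<^bold>* Idm 0) \<^bold>\<cdot> Cap"
      by (rule eqv_cmp_cong[OF closure_dot_poly eqv_refl]) simp_all
    also have "\<dots> \<simeq> ?\<beta> \<^bold>* (Idm 0 \<^bold>\<cdot> Cap)"
      by (rule eqv_cmp_scl_left) simp
    also have "\<dots> \<simeq> ?\<beta> \<^bold>* cap_poly 1"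
      by (rule eqv_scl_cong[OF eqv_trans[OF eqv_id_cmp eqv_sym[OF cap_poly_1]]]) simp
    also have "\<dots> \<simeq> cap_poly (smult ?\<beta> 1)"
      by (rule eqv_sym[OF cap_poly_smult])
    finally show ?thesis by simp
  qed
  have id_part: "cap_poly q \<^bold>\<cdot> (Idm 2 \<^bold>+ (-1) \<^bold>* (Cup \<^bold>\<cdot> Cap)) \<simeq> cap_poly (q + smult (-1) [:?\<beta>:])"
  proof -
    have "cap_poly q \<^bold>\<cdot> (Idm 2 \<^bold>+ (-1) \<^bold>* (Cup \<^bold>\<cdot> Cap))
        \<simeq> cap_poly q \<^bold>\<cdot> Idm 2 \<^bold>+ cap_poly q \<^bold>\<cdot> ((-1) \<^bold>* (Cup \<^bold>\<cdot> Cap))"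
      by (rule eqv_cmp_add_right) simp
    also have "\<dots> \<simeq> cap_poly q \<^bold>+ (-1) \<^bold>* (cap_poly q \<^bold>\<cdot> (Cup \<^bold>\<cdot> Cap))"
      by (rule eqv_add_cong[OF eqv_cmp_id eqv_cmp_scl_right]) simp_all
    also have "\<dots> \<simeq> cap_poly q \<^bold>+ (-1) \<^bold>* cap_poly [:?\<beta>:]"
      by (rule eqv_add_cong[OF eqv_refl eqv_scl_cong[OF turn_part]]) simp_all
    also have "\<dots> \<simeq> cap_poly q \<^bold>+ cap_poly (smult (-1) [:?\<beta>:])"
      by (rule eqv_add_cong[OF eqv_refl eqv_sym[OF cap_poly_smult]]) simp_all
    also have "\<dots> \<simeq> cap_poly (q + smult (-1) [:?\<beta>:])"
      by (rule eqv_sym[OF cap_poly_add])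
    finally show ?thesis .
  qed
  have shift_part: "cap_poly (pCons 0 q) \<^bold>\<cdot> Swap
      \<simeq> cap_poly (smult (-1) (pCons 0 ?h + (q + smult (-1) [:?\<beta>:])))"
  proof -
    have "cap_poly (pCons 0 q) \<^bold>\<cdot> Swap \<simeq> ((-1) \<^bold>* (cap_poly q \<^bold>\<cdot> ?D)) \<^bold>\<cdot> Swap"
      by (rule eqv_cmp_cong[OF cap_poly_slide_dot eqv_refl]) simp_all
    also have "\<dots> \<simeq> (-1) \<^bold>* (cap_poly q \<^bold>\<cdot> ?D \<^bold>\<cdot> Swap)"
      by (rule eqv_cmp_scl_left) simp
    also have "\<dots> \<simeq> (-1) \<^bold>* (cap_poly q \<^bold>\<cdot> (?D \<^bold>\<cdot> Swap))"
      by (rule eqv_scl_cong[OF eqv_cmp_assoc]) simp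
    also have "\<dots> \<simeq> (-1) \<^bold>* (cap_poly q \<^bold>\<cdot> (Swap \<^bold>\<cdot> ?D' \<^bold>+ (Idm 2 \<^bold>+ (-1) \<^bold>* (Cup \<^bold>\<cdot> Cap))))"
      by (rule eqv_scl_cong[OF eqv_cmp_cong[OF eqv_refl dot_swap]]) simp_all
    also have "\<dots> \<simeq> (-1) \<^bold>* (cap_poly q \<^bold>\<cdot> (Swap \<^bold>\<cdot> ?D')
        \<^bold>+ cap_poly q \<^bold>\<cdot> (Idm 2 \<^bold>+ (-1) \<^bold>* (Cup \<^bold>\<cdot> Cap)))"
      by (rule eqv_scl_cong[OF eqv_cmp_add_right]) simp
    also have "\<dots> \<simeq> (-1) \<^bold>* (cap_poly (pCons 0 ?h) \<^bold>+ cap_poly (q + smult (-1) [:?\<beta>:]))"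
      by (rule eqv_scl_cong[OF eqv_add_cong[OF swap_part id_part]]) simp
    also have "\<dots> \<simeq> (-1) \<^bold>* cap_poly (pCons 0 ?h + (q + smult (-1) [:?\<beta>:]))"
      by (rule eqv_scl_cong[OF eqv_sym[OF cap_poly_add]])
    also have "\<dots> \<simeq> cap_poly (smult (-1) (pCons 0 ?h + (q + smult (-1) [:?\<beta>:])))"
      by (rule eqv_sym[OF cap_poly_smult])
    finally show ?thesis .
  qed
  have const_part: "cap_poly (smult a 1) \<^bold>\<cdot> Swap \<simeq> cap_poly (smult a 1)"
  proof -
    have c: "cap_poly (smult a 1) \<simeq> a \<^bold>* Cap"
      by (rule eqv_trans[OF cap_poly_smult eqv_scl_cong[OF cap_poly_1]])
    have "cap_poly (smult a 1) \<^bold>\<cdot> Swap \<simeq> (a \<^bold>* Cap) \<^bold>\<cdot> Swap"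
      by (rule eqv_cmp_cong[OF c eqv_refl]) simp_all
    also have "\<dots> \<simeq> a \<^bold>* (Cap \<^bold>\<cdot> Swap)"
      by (rule eqv_cmp_scl_left) simp
    also have "\<dots> \<simeq> a \<^bold>* Cap"
      by (rule eqv_scl_cong[OF eqv_ab_relation[OF ab_relation.intros(5)]]) simp_all
    also have "\<dots> \<simeq> cap_poly (smult a 1)"
      by (rule eqv_sym[OF c])
    finally show ?thesis .
  qed
  have "cap_poly (pCons a q) = cap_poly (smult a 1 + pCons 0 q)"
    by simp
  then have "cap_poly (pCons a q) \<^bold>\<cdot> Swap
      \<simeq> (cap_poly (smult a 1) \<^bold>+ cap_poly (pCons 0 q)) \<^bold>\<cdot> Swap"
    using cap_poly_add[of "smult a 1" "pCons 0 q"]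
    by (intro eqv_cmp_cong eqv_refl) simp_all
  also have "\<dots> \<simeq> cap_poly (smult a 1) \<^bold>\<cdot> Swap \<^bold>+ cap_poly (pCons 0 q) \<^bold>\<cdot> Swap"
    by (rule eqv_cmp_add_left) simp
  also have "\<dots> \<simeq> cap_poly (smult a 1)
      \<^bold>+ cap_poly (smult (-1) (pCons 0 ?h + (q + smult (-1) [:?\<beta>:])))"
    by (rule eqv_add_cong[OF const_part shift_part]) simp
  also have "\<dots> \<simeq> cap_poly (smult a 1 + smult (-1) (pCons 0 ?h + (q + smult (-1) [:?\<beta>:])))"
    by (rule eqv_sym[OF cap_poly_add])
  also have "smult a 1 + smult (-1) (pCons 0 ?h + (q + smult (-1) [:?\<beta>:])) = curl b (pCons a q)"
    by (simp add: algebra_simps)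
  finally show ?case .
qed

end


section \<open>The generating series\<close>

text \<open>
  The polynomial part of \<open>q(u) \<Sum>\<^sub>n b\<^sub>n u\<^sup>-\<^sup>n\<^sup>-\<^sup>1\<close>, by recursion on the coefficients of \<open>q\<close>;
  see \<open>fls_poly_times_series\<close>.
\<close>

primrec poly_part_list :: "(nat \<Rightarrow> 'k::field) \<Rightarrow> 'k list \<Rightarrow> 'k poly" where
  "poly_part_list b [] = 0"
| "poly_part_list b (a # as) = pCons (moment b (Poly as) 0) (poly_part_list b as)"

definition poly_part :: "(nat \<Rightarrow> 'k::field) \<Rightarrow> 'k poly \<Rightarrow> 'k poly" where
  "poly_part b q = poly_part_list b (coeffs q)"

lemma poly_part_0 [simp]: "poly_part b 0 = 0"
  by (simp add: poly_part_def)

lemma poly_part_pCons [simp]: "poly_part b (pCons a q) = pCons (moment b q 0) (poly_part b q)"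
  by (simp add: poly_part_def cCons_def)

text \<open>
  The identity \<open>2u q'(u) = 2u q(-u) + q(-u) - q(u) + 2u g(-u)\<close> for the curl \<open>q'\<close> and the polynomial part \<open>g\<close>.
  The middle terms sum the corrections from the identity in the dot-crossing relation (a divided
  difference of \<open>q\<close> at \<open>u\<close> and \<open>-u\<close>), the last one those from \<open>cup cap\<close>.
\<close>

lemma curl_eq_poly_part:
  "[:0, 2:] * curl b q = [:0, 2:] * pcompose q [:0, -1:] + pcompose q [:0, -1:] - q
    + [:0, 2:] * pcompose (poly_part b q) [:0, -1:]"
proof (induction q)
  case 0
  show ?case by simp
next
  case (pCons a q)
  define u where "u = [:0, 1::'a:]"
  define q' where "q' = pcompose q [:0, -1:]"
  define e where "e = pcompose (poly_part b q) [:0, -1:]"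
  have neg: "[:0, -1:] = - u" and two: "[:0, 2:] = 2 * u"
    by (simp_all add: u_def numeral_poly)
  have comp: "pcompose (pCons c f) [:0, -1:] = [:c:] - u * pcompose f [:0, -1:]" for c f
    unfolding pcompose_pCons neg by simp
  have curl_step: "curl b (pCons a q) = [:a:] + [:moment b q 0:] - q - u * curl b q"
    and pCons_step: "pCons a q = [:a:] + u * q"
    by (simp_all add: u_def)
  have IH: "2 * u * curl b q = 2 * u * q' + q' - q + 2 * u * e"
    using pCons.IH unfolding q'_def[symmetric] e_def[symmetric] two .
  have "2 * u * curl b (pCons a q) = 2 * u * ([:a:] + [:moment b q 0:] - q) - u * (2 * u * curl b q)"
    unfolding curl_step by (simp add: algebra_simps)
  also have "\<dots> = 2 * u * ([:a:] + [:moment b q 0:] - q) - u * (2 * u * q' + q' - q + 2 * u * e)"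
    unfolding IH by simp
  also have "\<dots> = 2 * u * ([:a:] - u * q') + ([:a:] - u * q') - ([:a:] + u * q)
      + 2 * u * ([:moment b q 0:] - u * e)"
    by (simp add: algebra_simps smult_add_left)
  also have "\<dots> = 2 * u * pcompose (pCons a q) [:0, -1:] + pcompose (pCons a q) [:0, -1:] - pCons a q
      + 2 * u * pcompose (poly_part b (pCons a q)) [:0, -1:]"
    unfolding poly_part_pCons comp q'_def[symmetric] e_def[symmetric] by (simp only: pCons_step)
  finally show ?case unfolding two .
qed

text \<open>
  Multiplying the series \<open>\<Sum>\<^sub>n b\<^sub>n u\<^sup>-\<^sup>n\<^sup>-\<^sup>1\<close> by \<open>u\<close> shifts it and releases its first coefficient into the
  polynomial part; the negative part of the product consists of the moments of \<open>q\<close>.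
\<close>

lemma fls_poly_times_series:
  "fls_poly q fls_X_inv * fps_to_fls (fps_X * Abs_fps b)
    = fls_poly (poly_part b q) fls_X_inv + fps_to_fls (fps_X * Abs_fps (moment b q))"
proof (induction q)
  case 0
  show ?case by (simp add: fps_zero_def[symmetric])
next
  case (pCons a q)
  let ?u = "fls_X_inv :: 'a fls" and ?G = "\<lambda>f. fps_to_fls (fps_X * Abs_fps f)"
  have tail: "?u * ?G (moment b q) = fls_const (moment b q 0) + ?G (\<lambda>n. moment b q (Suc n))"
  proof -
    have "fps_X * Abs_fps (moment b q)
        = fps_X * (fps_const (moment b q 0) + fps_X * Abs_fps (\<lambda>n. moment b q (Suc n)))"
    proof (intro arg_cong[of _ _ "(*) fps_X"] fps_ext)
      show "Abs_fps (moment b q) $ n =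
          (fps_const (moment b q 0) + fps_X * Abs_fps (\<lambda>n. moment b q (Suc n))) $ n" for n
        by (cases n) simp_all
    qed
    then have "?G (moment b q) = fls_X * (fls_const (moment b q 0) + ?G (\<lambda>n. moment b q (Suc n)))"
      by (simp add: fls_times_fps_to_fls)
    moreover have "?u * fls_X = 1"
      by (metis fls_X_nonzero fls_inverse_X left_inverse)
    ultimately show ?thesis
      by (simp flip: mult.assoc)
  qed
  have head: "?G (moment b (pCons a q)) = fls_const a * ?G b + ?G (\<lambda>n. moment b q (Suc n))"
  proof -
    have "Abs_fps (moment b (pCons a q)) = fps_const a * Abs_fps b + Abs_fps (\<lambda>n. moment b q (Suc n))"
      by (rule fps_ext) simp
    then show ?thesis
      by (simp add: algebra_simps fls_times_fps_to_fls)
  qed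
  have "fls_poly (pCons a q) ?u * ?G b = fls_const a * ?G b + ?u * (fls_poly q ?u * ?G b)"
    by (simp add: algebra_simps)
  also have "\<dots> = fls_const a * ?G b + ?u * fls_poly (poly_part b q) ?u + ?u * ?G (moment b q)"
    unfolding pCons.IH by (simp add: algebra_simps)
  also have "\<dots> = fls_poly (poly_part b (pCons a q)) ?u + ?G (moment b (pCons a q))"
    unfolding tail head by (simp add: algebra_simps)
  finally show ?case .
qed

lemma scale_product:
  fixes u G S c :: "'a::comm_ring_1"
  assumes "2 * G = (S - 1) * (2 - c)"
  shows "2 * u * G = (S - 1) * (2 * u - u * c)"
proof -
  have "2 * u * G = u * ((S - 1) * (2 - c))"
    unfolding assms[symmetric] by (simp add: ac_simps)
  then show ?thesis by (simp add: algebra_simps)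
qed

text \<open>
  The algebra behind \<open>series_eq_O_poly\<close>, over an abstract field: \<open>G\<close> is the bubble series, \<open>S\<close> the series
  \<open>\<O>\<close>, \<open>M\<close> and \<open>M'\<close> are \<open>m(u)\<close> and \<open>m(-u)\<close>, \<open>s\<close> is the sign \<open>(-1)\<^sup>d\<close> and \<open>h\<close> is \<open>1/2\<close>.
\<close>

lemma solve_series:
  fixes u G S M M' s h :: "'a::field"
  assumes half: "2 * h = 1"
    and MG: "2 * u * (M * G) = 2 * u * s * M' - 2 * u * M + M - M'"
    and SG: "2 * u * G = (S - 1) * (2 * u - 1)"
    and nz: "M \<noteq> 0" "u - h \<noteq> 0"
  shows "S = (s * u - h) * M' / ((u - h) * M)"
proof -
  have "2 * (S * ((u - h) * M)) = S * ((2 * u - 2 * h) * M)"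
    by (simp add: algebra_simps)
  also have "\<dots> = (2 * u * G) * M + (2 * u - 1) * M"
    unfolding SG half by (simp add: algebra_simps)
  also have "\<dots> = (2 * u * s - 2 * h) * M'"
    unfolding half using MG by (simp add: algebra_simps)
  also have "\<dots> = 2 * ((s * u - h) * M')"
    by (simp add: algebra_simps)
  finally have "S * ((u - h) * M) = (s * u - h) * M'"
    using half by auto
  then show ?thesis using nz by (simp add: field_simps)
qed

text \<open>
  The vanishing moments make \<open>m(u) G(u)\<close> equal to its polynomial part \<open>g(u)\<close>, where \<open>G\<close> is the series of
  the \<open>b\<^sub>n\<close>. Comparing the value of the curl with \<open>curl_eq_poly_part\<close>, at \<open>-u\<close> in
  place of \<open>u\<close>, gives \<open>g\<close> in terms of \<open>m(u)\<close> and \<open>m(-u)\<close>.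
\<close>

lemma series_eq_O_poly:
  fixes m :: "'k::field poly"
  assumes two: "(2::'k) \<noteq> 0" and m: "m \<noteq> 0"
    and series: "2 * (fps_X * Abs_fps b) = (\<O> - 1) * (2 - fps_X)"
    and moments: "\<And>n. moment b m n = 0"
    and curl: "curl b m = smult ((-1) ^ degree m) m"
  shows "\<O> = O_poly m"
proof -
  let ?u = "fls_X_inv :: 'k fls" and ?F = "\<lambda>f. fls_poly f (fls_X_inv :: 'k fls)"
    and ?s = "(-1 :: 'k fls) ^ degree m"
  define G where "G = fps_to_fls (fps_X * Abs_fps b)"
  define S where "S = fps_to_fls \<O>"
  define M where "M = ?F m"
  define M' where "M' = fls_poly m (- ?u)"
  have Xu: "?u * fls_X = 1"
    by (metis fls_X_nonzero fls_inverse_X left_inverse)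
  have "fps_X * Abs_fps (moment b m) = 0"
    using moments by (simp add: fps_eq_iff)
  then have MG: "M * G = ?F (poly_part b m)"
    unfolding M_def G_def fls_poly_times_series by simp
  \<comment> \<open>the two expressions for the curl of \<open>m\<close>, evaluated at \<open>-u\<close>\<close>
  have "pcompose ([:0, 2:] * smult ((-1) ^ degree m) m) [:0, -1:] =
    pcompose ([:0, 2:] * pcompose m [:0, -1:] + pcompose m [:0, -1:] - m
    + [:0, 2:] * pcompose (poly_part b m) [:0, -1:]) [:0, -1:]"
    using curl_eq_poly_part[of b m] unfolding curl by simp
  then have "?F (pcompose ([:0, 2:] * smult ((-1) ^ degree m) m) [:0, -1:]) =
    ?F (pcompose ([:0, 2:] * pcompose m [:0, -1:] + pcompose m [:0, -1:] + smult (-1) m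
    + [:0, 2:] * pcompose (poly_part b m) [:0, -1:]) [:0, -1:])"
    by simp
  moreover have "?F (pcompose f [:0, -1:]) = fls_poly f (- ?u)" for f
    by (simp add: fls_poly_pcompose)
  moreover have "fls_poly (pcompose f [:0, -1:]) (- ?u) = ?F f" for f
    by (simp add: fls_poly_pcompose)
  moreover have "fls_poly [:0, 2:] v = 2 * v" for v :: "'k fls"
    by (simp add: mult.commute)
  moreover have "fls_const ((-1) ^ degree m) = ?s"
    by (cases "even (degree m)") simp_all
  ultimately have "2 * (- ?u) * (?s * M') = 2 * (- ?u) * M + M - M' + 2 * (- ?u) * ?F (poly_part b m)"
    unfolding M_def M'_def
    by (simp only: fls_poly_mult fls_poly_add fls_poly_smult) simp
  then have key: "2 * ?u * (M * G) = 2 * ?u * ?s * M' - 2 * ?u * M + M - M'"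
    unfolding MG by (simp add: algebra_simps)
  have "2 * G = (S - 1) * (2 - fls_X)"
  proof -
    have "fps_to_fls (2 * (fps_X * Abs_fps b)) = fps_to_fls ((\<O> - 1) * (2 - fps_X))"
      using series by simp
    then show ?thesis
      by (simp add: G_def S_def fls_times_fps_to_fls)
  qed
  then have "2 * ?u * G = (S - 1) * (2 * ?u - ?u * fls_X)"
    by (rule scale_product)
  then have SG: "2 * ?u * G = (S - 1) * (2 * ?u - 1)"
    unfolding Xu .
  have half: "2 * fls_const (1/2 :: 'k) = 1"
  proof -
    have "2 * fls_const (1/2 :: 'k) = fls_const (2 * (1/2))"
      by (simp only: fls_const_mult_const[symmetric] fls_const_numeral)
    then show ?thesis using two by simp
  qed
  have F0: "?F f \<noteq> 0" if "f \<noteq> 0" for f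
  proof
    assume "?F f = 0"
    then have "fps_to_fls (fps_of_poly (reflect_poly f)) = 0"
      unfolding fls_poly_reflect_poly by simp
    then show False using that by simp
  qed
  have M0: "M \<noteq> 0"
    unfolding M_def by (rule F0[OF m])
  have u0: "?u - fls_const (1/2) \<noteq> 0"
    using F0[of "[:-(1/2), 1:]"] by simp
  have "S = (?s * ?u - fls_const (1/2)) * M' / ((?u - fls_const (1/2)) * M)"
    by (rule solve_series[OF half key SG M0 u0])
  also have "\<dots> = fps_to_fls (O_poly m)"
    unfolding M_def M'_def by (rule fps_to_fls_O_poly[OF m, symmetric])
  finally show ?thesis
    by (simp add: S_def)
qed


section \<open>Quotient categories\<close>

context left_ideal
begin

definition cls :: "'k ab_term \<Rightarrow> 'k ab_term set set" where
  "cls t = coset AB J (ab_class t)"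

lemma diff_eqv_zero_iff:
  assumes "typed s a b" "typed t a b"
  shows "s \<^bold>+ (-1) \<^bold>* t \<simeq> Zer a b \<longleftrightarrow> s \<simeq> t"
proof
  have neg: "t \<^bold>+ (-1) \<^bold>* t \<simeq> Zer a b"
    using eqv_add_neg[of t] assms by (simp add: typed_iff)
  show "s \<^bold>+ (-1) \<^bold>* t \<simeq> Zer a b" if "s \<simeq> t"
    by (rule eqv_trans[OF eqv_add_cong[OF that eqv_refl] neg]) (use assms in \<open>auto simp: typed_iff\<close>)
  show "s \<simeq> t" if "s \<^bold>+ (-1) \<^bold>* t \<simeq> Zer a b"
  proof (rule eqv_add_cancel[of "(-1) \<^bold>* t"])
    have "(-1) \<^bold>* t \<^bold>+ s \<simeq> s \<^bold>+ (-1) \<^bold>* t"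
      by (rule eqv_add_commute) (use assms in \<open>simp add: typed_iff\<close>)
    also note that
    also have "Zer a b \<simeq> t \<^bold>+ (-1) \<^bold>* t"
      by (rule eqv_sym[OF neg])
    also have "\<dots> \<simeq> (-1) \<^bold>* t \<^bold>+ t"
      by (rule eqv_add_commute) (use assms in \<open>simp add: typed_iff\<close>)
    finally show "(-1) \<^bold>* t \<^bold>+ s \<simeq> (-1) \<^bold>* t \<^bold>+ t" .
  qed
qed

lemma sub_mem_J_iff:
  assumes "typed s a b" "typed t a b"
  shows "sub AB (ab_class s) (ab_class t) \<in> J a b \<longleftrightarrow> s \<simeq> t"
proof -
  have "typed (s \<^bold>+ (-1) \<^bold>* t) a b"
    using assms by (simp add: typed_iff)
  then show ?thesis
    using assms mem_J_iff[of "s \<^bold>+ (-1) \<^bold>* t" a b] diff_eqv_zero_iff[OF assms]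
    by (simp add: sub_AB typed_iff)
qed

lemma cls_eq:
  assumes "well_typed t"
  shows "cls t = ab_class ` {s. s \<simeq> t}"
proof -
  define a b where "a = fst (type_of t)" and "b = snd (type_of t)"
  then have t: "typed t a b" using assms by (simp add: well_typed_imp_typed)
  then have hom_t: "ab_class t \<in> hom AB a b" by (auto simp: AB_simps)
  have "cls t = {g. g \<in> hom AB a b \<and> sub AB g (ab_class t) \<in> J a b}"
    unfolding cls_def coset_def using hom_t AB_hom_disjoint[OF hom_t] by blast
  also have "\<dots> = ab_class ` {s. typed s a b \<and> sub AB (ab_class s) (ab_class t) \<in> J a b}"
    by (auto simp: AB_simps)
  also have "{s. typed s a b \<and> sub AB (ab_class s) (ab_class t) \<in> J a b} = {s. s \<simeq> t}"
  proof (intro Collect_cong iffI)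
    show "s \<simeq> t" if "typed s a b \<and> sub AB (ab_class s) (ab_class t) \<in> J a b" for s
      using that sub_mem_J_iff[OF _ t] by blast
    show "typed s a b \<and> sub AB (ab_class s) (ab_class t) \<in> J a b" if "s \<simeq> t" for s
    proof -
      have "typed s a b" using eqv_type[OF that] t by (simp add: typed_iff)
      then show ?thesis using that sub_mem_J_iff[OF _ t] by blast
    qed
  qed
  finally show ?thesis .
qed

lemma cls_eq_iff:
  assumes "well_typed s" "well_typed t"
  shows "cls s = cls t \<longleftrightarrow> s \<simeq> t"
proof
  assume "s \<simeq> t"
  then have "r \<simeq> s \<longleftrightarrow> r \<simeq> t" for r
    using eqv_trans eqv_sym by blast
  then show "cls s = cls t"
    using assms by (simp add: cls_eq)
next
  assume "cls s = cls t"
  moreover have "ab_class s \<in> cls s"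
    using assms eqv_refl by (auto simp: cls_eq)
  ultimately obtain r where r: "r \<simeq> t" "ab_class s = ab_class r"
    using assms by (auto simp: cls_eq)
  have s: "typed s (fst (type_of s)) (snd (type_of s))"
    using assms by (rule_tac well_typed_imp_typed)
  then have "s \<in> ab_class r"
    using r(2) ab_eq.refl mem_ab_class_iff by metis
  then obtain a b where "ab_eq a b r s"
    unfolding ab_class_def by blast
  then show "s \<simeq> t"
    using r(1) eqv_sym eqv_of_ab_eq eqv_trans by blast
qed

lemma cls_UN:
  assumes "well_typed t" and "\<And>s. s \<simeq> t \<Longrightarrow> coset AB J (F (ab_class s)) = cls u"
  shows "(\<Union>f \<in> cls t. coset AB J (F f)) = cls u"
  using assms eqv_refl[of t] by (auto simp: cls_eq)

lemma cls_UN2: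
  assumes "well_typed t" "well_typed t'"
    and "\<And>s s'. s \<simeq> t \<Longrightarrow> s' \<simeq> t' \<Longrightarrow> coset AB J (F (ab_class s) (ab_class s')) = cls u"
  shows "(\<Union>f \<in> cls t. \<Union>f' \<in> cls t'. coset AB J (F f f')) = cls u"
  using assms eqv_refl[of t] eqv_refl[of t'] by (auto simp: cls_eq)

abbreviation "Q \<equiv> quotient_category AB J"

lemma quotient_simps:
  "hom Q a b = cls ` {t. typed t a b}"
  "idm Q a = cls (Idm a)"
  "zer Q a b = cls (Zer a b)"
  by (auto simp: quotient_category_def AB_simps cls_def)

lemma cmp_quotient:
  assumes "well_typed (t \<^bold>\<cdot> s)"
  shows "cmp Q (cls t) (cls s) = cls (t \<^bold>\<cdot> s)"
  unfolding quotient_category_def linear_category.simps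
proof (rule cls_UN2)
  fix t' s'
  assume eqv: "t' \<simeq> t" "s' \<simeq> s"
  then have wt: "well_typed (t' \<^bold>\<cdot> s')"
    using assms eqv_type by fastforce
  then have "t' \<^bold>\<cdot> s' \<simeq> t \<^bold>\<cdot> s"
    by (rule eqv_cmp_cong[OF eqv])
  then have "cls (t' \<^bold>\<cdot> s') = cls (t \<^bold>\<cdot> s)"
    using cls_eq_iff[OF wt assms] by blast
  then show "coset AB J (cmp AB (ab_class t') (ab_class s')) = cls (t \<^bold>\<cdot> s)"
    using wt by (simp add: cmp_AB cls_def)
qed (use assms in auto)

lemma add_quotient:
  assumes "well_typed (s \<^bold>+ t)"
  shows "add Q (cls s) (cls t) = cls (s \<^bold>+ t)"
  unfolding quotient_category_def linear_category.simps
proof (rule cls_UN2)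
  fix s' t'
  assume eqv: "s' \<simeq> s" "t' \<simeq> t"
  then have wt: "well_typed (s' \<^bold>+ t')"
    using assms eqv_type by fastforce
  then have "s' \<^bold>+ t' \<simeq> s \<^bold>+ t"
    by (rule eqv_add_cong[OF eqv])
  then have "cls (s' \<^bold>+ t') = cls (s \<^bold>+ t)"
    using cls_eq_iff[OF wt assms] by blast
  then show "coset AB J (add AB (ab_class s') (ab_class t')) = cls (s \<^bold>+ t)"
    using wt by (simp add: add_AB cls_def)
qed (use assms in auto)

lemma scl_quotient:
  assumes "well_typed t"
  shows "scl Q c (cls t) = cls (c \<^bold>* t)"
  unfolding quotient_category_def linear_category.simps
proof (rule cls_UN[OF assms])
  fix s
  assume eqv: "s \<simeq> t"
  then have wt: "well_typed s"
    using eqv_type by blast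
  have "cls (c \<^bold>* s) = cls (c \<^bold>* t)"
    using cls_eq_iff[of "c \<^bold>* s" "c \<^bold>* t"] wt assms eqv_scl_cong[OF eqv] by simp
  then show "coset AB J (scl AB c (ab_class s)) = cls (c \<^bold>* t)"
    using wt by (simp add: scl_AB cls_def)
qed

lemma lsum_quotient:
  assumes "\<And>i. typed (f i) a b"
  shows "lsum Q a b (\<lambda>i. cls (f i)) n = cls (term_sum a b f n)"
  using assms by (induction n) (auto simp: quotient_simps add_quotient typed_iff)

lemma end_poly_quotient: "end_poly Q 1 (cls Dot) q = cls (dot_poly q)"
proof -
  have "epow Q 1 (cls Dot) n = cls (dot_power n)" for n
    by (induction n) (simp_all add: quotient_simps cmp_quotient)
  then show ?thesis
    unfolding end_poly_def dot_poly_def dot_sum_def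
    by (simp only: scl_quotient type_dot_power) (rule lsum_quotient, simp add: typed_iff)
qed

text \<open>
  If the identity of the unit object is in \<open>J\<close>, then so is \<open>I\<^sup>a \<otimes> 1\<close>, the identity of the \<open>a\<close>-th tensor
  power, and with it every morphism.
\<close>

lemma zero_quotient_iff: "zero_category Q \<longleftrightarrow> Idm 0 \<simeq> Zer 0 0"
proof
  assume "zero_category Q"
  then have "hom Q 0 0 = {zer Q 0 0}"
    by (simp add: zero_category_def)
  moreover have "cls (Idm 0) \<in> hom Q 0 0"
    by (auto simp: quotient_simps typed_iff)
  ultimately show "Idm 0 \<simeq> Zer 0 0"
    by (simp add: quotient_simps cls_eq_iff)
next
  assume unit: "Idm 0 \<simeq> Zer 0 0"
  have "t \<simeq> Zer a b" if t: "typed t a b" for t a b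
  proof -
    have "Idm a \<simeq> Idm a \<^bold>\<otimes> Idm 0"
      by (rule eqv_sym[OF eqv_tens_unit]) simp
    also have "\<dots> \<simeq> Idm a \<^bold>\<otimes> Zer 0 0"
      by (rule eqv_tens_cong[OF unit])
    also have "\<dots> \<simeq> Zer a a"
      using eqv_tens_zero[of a 0 0] by simp
    finally have id: "Idm a \<simeq> Zer a a" .
    have "t \<simeq> t \<^bold>\<cdot> Idm a"
      by (rule eqv_sym[OF eqv_cmp_id]) (use t in \<open>simp add: typed_iff\<close>)
    also have "\<dots> \<simeq> t \<^bold>\<cdot> Zer a a"
      by (rule eqv_cmp_cong[OF eqv_refl id]) (use t in \<open>simp_all add: typed_iff\<close>)
    also have "\<dots> \<simeq> Zer a b"
      by (rule eqv_cmp_zero[OF t])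
    finally show ?thesis .
  qed
  then have "cls t = cls (Zer a b)" if "typed t a b" for t a b
    using that by (simp add: cls_eq_iff typed_iff)
  moreover have "typed (Zer a b :: 'k ab_term) a b" for a b
    by (simp add: typed_iff)
  ultimately show "zero_category Q"
    unfolding zero_category_def quotient_simps by blast
qed

end

lemma module_category_iso_refl: "module_category_iso A M M id id"
  by (simp add: module_category_iso_def)

section \<open>Cyclotomic ideals\<close>

lemma lsum_AB:
  assumes "\<And>i. typed (f i) a b"
  shows "lsum AB a b (\<lambda>i. ab_class (f i)) n = ab_class (term_sum a b f n)"
  using assms by (induction n) (auto simp: AB_simps add_AB typed_iff)

lemma epow_AB: "epow AB 1 dot n = ab_class (dot_power n)"
  by (induction n) (simp_all add: AB_simps dot_def cmp_AB)

lemma end_poly_AB: "end_poly AB 1 dot q = ab_class (dot_poly q)"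
  unfolding end_poly_def dot_poly_def dot_sum_def epow_AB
  by (simp only: scl_AB type_dot_power) (rule lsum_AB, simp add: typed_iff)

definition bubble_term :: "nat \<Rightarrow> 'k::field ab_term" where
  "bubble_term n = Cap \<^bold>\<cdot> (\<^bold>I \<^bold>\<otimes> dot_power n \<^bold>\<cdot> Cup)"

definition beta_term :: "nat \<Rightarrow> 'k::field ab_term" where
  "beta_term r = term_sum 0 0 (\<lambda>n. fps_nth (2 / (2 - fps_X)) (r - n) \<^bold>* bubble_term n) (Suc r)"

lemma type_bubble_term [simp]:
  "well_typed (bubble_term n :: 'k::field ab_term)"
  "type_of (bubble_term n :: 'k::field ab_term) = (0, 0)"
  by (simp_all add: bubble_term_def)

lemma type_beta_term [simp]:
  "well_typed (beta_term n :: 'k::field ab_term)"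
  "type_of (beta_term n :: 'k::field ab_term) = (0, 0)"
  by (simp_all add: beta_term_def typed_iff)

lemma bubble_eq: "bubble n = ab_class (bubble_term n)"
  unfolding bubble_def bubble_term_def epow_AB cap_def cup_def AB_simps
  by (simp add: tens_AB cmp_AB)

lemma beta_eq: "beta (Suc r) = ab_class (beta_term r)"
  unfolding beta.simps beta_term_def bubble_eq
  by (simp only: scl_AB type_bubble_term) (rule lsum_AB, simp add: typed_iff)

lemma left_ideal_cyclotomic: "left_ideal (cyclotomic_ideal p \<O>)"
proof (unfold_locales, unfold cyclotomic_ideal_def, rule left_tensor_ideal_generated)
  fix a b
  show "cyclotomic_generators p \<O> a b \<subseteq> hom AB a b"
    unfolding cyclotomic_generators_def end_poly_AB beta_eq
    by (auto simp: AB_simps scl_AB sub_AB typed_iff)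
qed

lemma generators_subset_cyclotomic:
  "cyclotomic_generators p \<O> a b \<subseteq> cyclotomic_ideal p \<O> a b"
  unfolding cyclotomic_ideal_def by (rule generated_left_tensor_ideal_superset)

lemma dot_poly_mem_cyclotomic: "ab_class (dot_poly p) \<in> cyclotomic_ideal p \<O> 1 1"
  using generators_subset_cyclotomic[of p \<O> 1 1]
  unfolding cyclotomic_generators_def end_poly_AB by simp

lemma beta_mem_cyclotomic:
  "sub AB (ab_class (beta_term r)) (ab_class (fps_nth \<O> (Suc r) \<^bold>* Idm 0)) \<in> cyclotomic_ideal p \<O> 0 0"
  using generators_subset_cyclotomic[of p \<O> 0 0]
  unfolding cyclotomic_generators_def beta_eq AB_simps by (auto simp: scl_AB)

text \<open>
  Both ideals contain the same bubble relations, so only the generator \<open>p(x)\<close> has to be compared.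
\<close>

lemma cyclotomic_ideal_mono:
  assumes "ab_class (dot_poly p) \<in> cyclotomic_ideal q \<O> 1 1"
  shows "cyclotomic_ideal p \<O> a b \<subseteq> cyclotomic_ideal q \<O> a b"
  unfolding cyclotomic_ideal_def[of p]
proof (rule generated_left_tensor_ideal_least)
  show "left_tensor_ideal AB (cyclotomic_ideal q \<O>)"
    using left_ideal_cyclotomic by (simp add: left_ideal_def)
  show "cyclotomic_generators p \<O> a b \<subseteq> cyclotomic_ideal q \<O> a b" for a b
  proof (cases "a = 1 \<and> b = 1")
    case True
    then have "cyclotomic_generators p \<O> a b = {ab_class (dot_poly p)}"
      unfolding cyclotomic_generators_def end_poly_AB by simp
    then show ?thesis using assms True by simp
  next
    case False
    then have "cyclotomic_generators p \<O> a b = cyclotomic_generators q \<O> a b"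
      by (simp only: cyclotomic_generators_def if_False)
    then show ?thesis using generators_subset_cyclotomic by simp
  qed
qed

section \<open>The minimal polynomial determines the series\<close>

lemma (in left_ideal) term_sum_scalars:
  assumes "\<And>i. i < n \<Longrightarrow> t i \<simeq> c i \<^bold>* Idm 0"
  shows "term_sum 0 0 t n \<simeq> (\<Sum>i<n. c i) \<^bold>* Idm 0"
  using assms
proof (induction n)
  case 0
  have "typed (Idm 0 :: 'k ab_term) 0 0" by (simp add: typed_iff)
  from eqv_sym[OF eqv_zero_scl[OF this]] show ?case by simp
next
  case (Suc n)
  have "typed (t i) 0 0" if "i < Suc n" for i
    using eqv_type[OF Suc.prems[OF that]] by (simp add: typed_iff)
  then have wt: "well_typed (term_sum 0 0 t n \<^bold>+ t n)"
    by (simp add: typed_iff)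
  have "term_sum 0 0 t (Suc n) \<simeq> (\<Sum>i<n. c i) \<^bold>* Idm 0 \<^bold>+ c n \<^bold>* Idm 0"
    unfolding term_sum.simps using Suc wt by (intro eqv_add_cong) simp_all
  also have "\<dots> \<simeq> (\<Sum>i<Suc n. c i) \<^bold>* Idm 0"
    unfolding sum.lessThan_Suc by (rule eqv_sym[OF eqv_add_scl]) simp
  finally show ?case .
qed

text \<open>
  The relations give the values of the coefficients of \<open>2u/(2u-1) \<Sum>\<^sub>n bubble\<^sub>n u\<^sup>-\<^sup>n\<^sup>-\<^sup>1\<close>. As
  \<open>2u/(2u-1)\<close> has constant coefficient 1, this is a unitriangular system for the bubbles.
\<close>

lemma (in left_ideal) bubble_scalars:
  fixes \<O> :: "'k fps"
  assumes two: "(2::'k) \<noteq> 0"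
    and beta: "\<And>r. beta_term r \<simeq> fps_nth \<O> (Suc r) \<^bold>* Idm 0"
    and series: "2 * (fps_X * Abs_fps b) = (\<O> - 1) * (2 - fps_X)"
  shows "bubble_term n \<simeq> b n \<^bold>* Idm 0"
proof (induction n rule: less_induct)
  case (less n)
  define c :: "nat \<Rightarrow> 'k" where "c = fps_nth (2 / (2 - fps_X))"
  have unit: "(2 - fps_X :: 'k fps) $ 0 \<noteq> 0"
    using two by simp
  have c_mult: "Abs_fps c * (2 - fps_X) = 2"
  proof -
    have "2 / (2 - fps_X :: 'k fps) = 2 * inverse (2 - fps_X)"
      using unit by (simp add: fps_divide_unit)
    then show ?thesis
      using inverse_mult_eq_1[OF unit] by (simp add: c_def fps_nth_inverse mult.assoc)
  qed
  have c0: "c 0 = 1"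
  proof -
    have "(Abs_fps c * (2 - fps_X)) $ 0 = 2" by (simp add: c_mult)
    then show ?thesis using two by simp
  qed
  have "2 * (\<O> - 1) = 2 * ((fps_X * Abs_fps b) * Abs_fps c)"
  proof -
    have "2 * (\<O> - 1) = (\<O> - 1) * (Abs_fps c * (2 - fps_X))"
      unfolding c_mult by simp
    also have "\<dots> = ((\<O> - 1) * (2 - fps_X)) * Abs_fps c"
      by (simp add: ac_simps)
    finally show ?thesis
      unfolding series[symmetric] by (simp add: ac_simps)
  qed
  moreover have "(2 :: 'k fps) \<noteq> 0"
    using unit by (metis c_mult fps_nonzero_nth fps_numeral_nth_0 two)
  ultimately have O: "\<O> - 1 = fps_X * (Abs_fps b * Abs_fps c)"
    by (simp only: mult_cancel_left mult.assoc) simp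
  have "fps_nth \<O> (Suc n) = (\<O> - 1) $ Suc n"
    by simp
  also have "\<dots> = (\<Sum>i=0..n. b i * c (n - i))"
    unfolding O by (simp only: fps_X_mult_nth) (simp add: fps_mult_nth)
  also have "\<dots> = (\<Sum>i<Suc n. c (n - i) * b i)"
    by (rule sum.cong) (auto simp: mult.commute)
  also have "\<dots> = (\<Sum>i<n. c (n - i) * b i) + b n"
    by (simp add: c0)
  finally have On: "fps_nth \<O> (Suc n) = (\<Sum>i<n. c (n - i) * b i) + b n" .
  let ?S = "term_sum 0 0 (\<lambda>i. c (n - i) \<^bold>* bubble_term i) n" and ?s = "\<Sum>i<n. c (n - i) * b i"
  have S: "?S \<simeq> ?s \<^bold>* Idm 0"
  proof (rule term_sum_scalars)
    fix i assume "i < n"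
    then show "c (n - i) \<^bold>* bubble_term i \<simeq> (c (n - i) * b i) \<^bold>* Idm 0"
      using eqv_trans[OF eqv_scl_cong[OF less.IH] eqv_scl_scl] by simp
  qed
  show ?case
  proof (rule eqv_add_cancel[of "?s \<^bold>* Idm 0"])
    have "?s \<^bold>* Idm 0 \<^bold>+ bubble_term n \<simeq> ?S \<^bold>+ c (n - n) \<^bold>* bubble_term n"
      using eqv_sym[OF eqv_scl_one[of "bubble_term n"]]
      by (intro eqv_add_cong eqv_sym[OF S]) (simp_all add: c0)
    also have "\<dots> = beta_term n"
      by (simp add: beta_term_def c_def)
    also have "beta_term n \<simeq> (?s + b n) \<^bold>* Idm 0"
      using beta[of n] unfolding On .
    also have "\<dots> \<simeq> ?s \<^bold>* Idm 0 \<^bold>+ b n \<^bold>* Idm 0"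
      by (rule eqv_add_scl) simp
    finally show "?s \<^bold>* Idm 0 \<^bold>+ bubble_term n \<simeq> ?s \<^bold>* Idm 0 \<^bold>+ b n \<^bold>* Idm 0" .
  qed
qed

text \<open>
  The difference of the two sides is a multiple of \<open>m\<close> of degree less than \<open>deg m\<close>.
\<close>

lemma multiple_eq_smult:
  fixes m f :: "'a::field poly"
  assumes dvd: "m dvd f"
    and deg: "degree f \<le> degree m"
    and lead: "coeff f (degree m) = c * lead_coeff m"
  shows "f = smult c m"
proof (rule ccontr)
  assume "f \<noteq> smult c m"
  then have nz: "f - smult c m \<noteq> 0" by simp
  have "m dvd f - smult c m"
    by (intro dvd_diff dvd dvd_smult dvd_refl)
  then have "degree m \<le> degree (f - smult c m)"
    using nz by (rule dvd_imp_degree_le)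
  moreover have "coeff (f - smult c m) n = 0" if "degree m \<le> n" for n
    using that deg lead by (cases "n = degree m") (auto simp: coeff_eq_0)
  ultimately show False
    using nz leading_coeff_0_iff by blast
qed

text \<open>
  As \<open>m(x) = 0\<close>, also \<open>c(m') = c(m) s = 0\<close> for the curl \<open>m'\<close> of \<open>m\<close>. Hence \<open>m'(x) = 0\<close>, so \<open>m'\<close> is a multiple of \<open>m\<close>,
  and its degree leaves only a scalar factor, read off from the coefficient of \<open>u\<^sup>d\<close>.
\<close>

lemma (in scalar_bubbles) curl_min_poly:
  assumes ker: "\<And>q. dot_poly q \<simeq> Zer 1 1 \<longleftrightarrow> m dvd q"
  shows "curl b m = smult ((-1) ^ degree m) m"
proof -
  have z: "cap_poly m \<simeq> Zer 2 0"
    by (rule cap_poly_zero, rule ker[THEN iffD2]) simp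
  have "cap_poly (curl b m) \<simeq> cap_poly m \<^bold>\<cdot> Swap"
    by (rule eqv_sym[OF cap_poly_swap])
  also have "\<dots> \<simeq> Zer 2 0 \<^bold>\<cdot> Swap"
    by (rule eqv_cmp_cong[OF z eqv_refl]) simp_all
  also have "\<dots> \<simeq> Zer 2 0"
    by (rule eqv_zero_cmp) (simp add: typed_iff)
  finally have "m dvd curl b m"
    using dot_poly_eqv_zero_if_cap_poly ker by blast
  then show ?thesis
  proof (rule multiple_eq_smult)
    show "degree (curl b m) \<le> degree m"
      by (rule degree_le) (simp add: coeff_curl coeff_eq_0)
  qed (simp add: coeff_curl)
qed

text \<open>
  The bubble decorated by \<open>x\<^sup>n m(x) = 0\<close> is zero; but it is the scalar \<open>moment b m n\<close>, and a
  nonzero scalar would make the identity of the unit object vanish.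
\<close>

lemma (in scalar_bubbles) moment_eq_0:
  assumes "dot_poly m \<simeq> Zer 1 1" and nonzero: "\<not> Idm 0 \<simeq> Zer 0 0"
  shows "moment b m n = 0"
proof (rule ccontr)
  assume nz: "moment b m n \<noteq> 0"
  have ty: "typed (closure (Idm 1)) 0 0" "typed (Idm 1 :: 'k ab_term) 1 1"
    by (auto simp: typed_iff)
  have "dot_poly (monom 1 n * m) \<simeq> 0 \<^bold>* Idm 1"
    by (rule eqv_trans[OF dot_poly_mult_eqv_zero[OF assms(1)] eqv_sym[OF eqv_zero_scl[OF ty(2)]]])
  then have "closure (dot_poly (monom 1 n * m)) \<simeq> closure (0 \<^bold>* Idm 1)"
    by (rule closure_cong) simp
  also have "\<dots> \<simeq> 0 \<^bold>* closure (Idm 1)"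
    by (rule closure_scl) simp_all
  also have "\<dots> \<simeq> Zer 0 0"
    by (rule eqv_zero_scl[OF ty(1)])
  finally have z: "moment b m n \<^bold>* Idm 0 \<simeq> Zer 0 0"
    using closure_dot_poly[of "monom 1 n * m"] eqv_trans eqv_sym
    unfolding moment_monom_mult add_0 by blast
  have "Idm 0 \<simeq> 1 \<^bold>* Idm 0"
    by (rule eqv_sym[OF eqv_scl_one]) simp
  also have "1 \<^bold>* Idm 0 = (inverse (moment b m n) * moment b m n) \<^bold>* Idm 0"
    using nz by simp
  also have "\<dots> \<simeq> inverse (moment b m n) \<^bold>* moment b m n \<^bold>* Idm 0"
    by (rule eqv_sym[OF eqv_scl_scl]) simp
  also have "\<dots> \<simeq> inverse (moment b m n) \<^bold>* Zer 0 0"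
    by (rule eqv_scl_cong[OF z])
  also have "\<dots> \<simeq> Zer 0 0"
    by (rule eqv_scl_zero)
  finally show False using nonzero by blast
qed

text \<open>
  Euclidean division by a nonzero annihilating polynomial of least degree, made monic.
\<close>

lemma (in left_ideal) ex_min_poly:
  assumes "dot_poly p \<simeq> Zer 1 1" "p \<noteq> 0"
  shows "\<exists>m. lead_coeff m = 1 \<and> (\<forall>q. dot_poly q \<simeq> Zer 1 1 \<longleftrightarrow> m dvd q)"
proof -
  let ?K = "\<lambda>q. dot_poly q \<simeq> Zer 1 1 \<and> q \<noteq> 0"
  obtain m where m: "?K m" and least: "\<And>q. ?K q \<Longrightarrow> degree m \<le> degree q"
    using ex_has_least_nat[of ?K p degree] assms by blast
  have "m dvd q" if q: "dot_poly q \<simeq> Zer 1 1" for q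
  proof (rule ccontr)
    assume "\<not> m dvd q"
    then have nz: "q mod m \<noteq> 0" by (simp add: dvd_eq_mod_eq_0)
    have "q mod m = q + (- (q div m)) * m"
      by (simp add: minus_div_mult_eq_mod)
    then have "dot_poly (q mod m) \<simeq> dot_poly q \<^bold>+ dot_poly (- (q div m) * m)"
      using dot_poly_add[of q "- (q div m) * m"] by (simp only:)
    also have "\<dots> \<simeq> Zer 1 1 \<^bold>+ Zer 1 1"
      using m by (intro eqv_add_cong q dot_poly_mult_eqv_zero) simp_all
    also have "\<dots> \<simeq> Zer 1 1"
      by (rule eqv_add_zero) simp
    finally have "degree m \<le> degree (q mod m)"
      using least nz by blast
    then show False
      using degree_mod_less[of m q] m nz by auto
  qed
  moreover have "dot_poly q \<simeq> Zer 1 1" if "m dvd q" for q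
    using that m dot_poly_mult_eqv_zero by (metis dvd_div_mult_self)
  ultimately have ker: "dot_poly q \<simeq> Zer 1 1 \<longleftrightarrow> m dvd q" for q
    by blast
  show ?thesis
  proof (intro exI conjI allI)
    show "lead_coeff (smult (inverse (lead_coeff m)) m) = 1"
      using m by simp
    show "dot_poly q \<simeq> Zer 1 1 \<longleftrightarrow> smult (inverse (lead_coeff m)) m dvd q" for q
      using m by (simp only: ker) (simp add: smult_dvd_iff)
  qed
qed

lemma (in left_ideal) series_determined_by_min_poly:
  fixes \<O> :: "'k fps"
  assumes two: "(2::'k) \<noteq> 0"
    and const: "fps_nth \<O> 0 = 1"
    and beta: "\<And>r. beta_term r \<simeq> fps_nth \<O> (Suc r) \<^bold>* Idm 0"
    and nonzero: "\<not> Idm 0 \<simeq> Zer 0 0"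
    and m: "lead_coeff m = 1" "\<And>q. dot_poly q \<simeq> Zer 1 1 \<longleftrightarrow> m dvd q"
  shows "\<O> = O_poly m"
proof -
  \<comment> \<open>the values that the series \<open>\<O>\<close> forces on the bubbles: \<open>B\<close> is \<open>(2u-1)/(2u) (\<O> - 1)\<close>, as \<open>fps_X\<close> is \<open>u\<^sup>-\<^sup>1\<close>\<close>
  define B where "B = fps_const (1/2) * ((\<O> - 1) * (2 - fps_X))"
  define b where "b n = fps_nth B (Suc n)" for n
  have "fps_nth B 0 = 0"
    using const by (simp add: B_def)
  then have "fps_X * Abs_fps b = B"
    by (intro fps_ext) (simp add: b_def)
  moreover have "2 * fps_const (1/2) = (1 :: 'k fps)"
    using two by (simp add: fps_numeral_fps_const)
  ultimately have series: "2 * (fps_X * Abs_fps b) = (\<O> - 1) * (2 - fps_X)"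
    by (simp add: B_def flip: mult.assoc)
  have "closure (dot_power n) \<simeq> bubble_term n" for n
    unfolding closure_def bubble_term_def by (rule eqv_cmp_assoc) simp
  then interpret scalar_bubbles J b
    using bubble_scalars[OF two beta series] eqv_trans by unfold_locales blast
  show ?thesis
  proof (rule series_eq_O_poly[OF two _ series])
    show "m \<noteq> 0" using m(1) by auto
    show "moment b m n = 0" for n
      by (rule moment_eq_0[OF _ nonzero], rule m(2)[THEN iffD2]) simp
    show "curl b m = smult ((-1) ^ degree m) m"
      by (rule curl_min_poly[OF m(2)])
  qed
qed

theorem corollary6p4:
  fixes p :: "'k::field poly" and \<O> :: "'k fps"
  assumes "CHAR('k) \<noteq> 2"
    and "lead_coeff p = 1"
    and "fps_nth \<O> 0 = 1"
    and "\<O> * fps_compose \<O> (- fps_X) = 1"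
    and "\<not> zero_category (CB p \<O>)"
  shows "isomorphic_module_categories AB (CB p \<O>) (CB_poly (m_L p \<O>))"
proof -
  have two: "(2::'k) \<noteq> 0"
  proof
    assume "(2::'k) = 0"
    then have "CHAR('k) dvd 2"
      using of_nat_eq_0_iff_char_dvd[of 2, where 'a = 'k] by simp
    then have "CHAR('k) = 1 \<or> CHAR('k) = 2"
      using two_is_prime_nat prime_nat_iff by blast
    then show False
      using assms(1) by simp
  qed
  define J where "J = cyclotomic_ideal p \<O>"
  interpret left_ideal J
    unfolding J_def by (rule left_ideal_cyclotomic)
  have p: "eqv (dot_poly p) (Zer 1 1)"
    by (rule mem_J_iff[THEN iffD1]) (simp_all add: J_def dot_poly_mem_cyclotomic[simplified] typed_iff)
  have beta: "eqv (beta_term r) (fps_nth \<O> (Suc r) \<^bold>* Idm 0)" for r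
    using beta_mem_cyclotomic[of r \<O> p] unfolding J_def[symmetric]
    by (rule sub_mem_J_iff[THEN iffD1, rotated -1]) (simp_all add: typed_iff)
  obtain m where m: "lead_coeff m = 1" "\<And>q. eqv (dot_poly q) (Zer 1 1) \<longleftrightarrow> m dvd q"
    using ex_min_poly[OF p] assms(2) by fastforce
  have "m_L p \<O> = m"
  proof -
    have ker: "end_poly Q 1 (cls Dot) q = zer Q 1 1 \<longleftrightarrow> m dvd q" for q
      unfolding end_poly_quotient quotient_simps m(2)[symmetric]
      by (rule cls_eq_iff) simp_all
    have "m_L p \<O> = (THE m'. lead_coeff m' = 1 \<and> {q. m dvd q} = {q. m' dvd q})"
      unfolding m_L_def end_min_poly_def CB_def J_def[symmetric] dot_def cls_def[symmetric] ker ..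
    also have "\<dots> = m"
    proof (rule the_equality)
      fix m' assume m': "lead_coeff m' = 1 \<and> {q. m dvd q} = {q. m' dvd q}"
      then have dvd: "m' dvd m" "m dvd m'" using dvd_refl by blast+
      have nz: "m \<noteq> 0" "m' \<noteq> 0" using m(1) m' by auto
      then have "degree m' = degree m"
        using dvd dvd_imp_degree_le by (metis le_antisym)
      then have "m' = smult 1 m"
        using m(1) m' by (intro multiple_eq_smult dvd) simp_all
      then show "m' = m" by simp
    qed (use m in simp)
    finally show ?thesis .
  qed
  moreover have "\<O> = O_poly m"
  proof (rule series_determined_by_min_poly[OF two assms(3) beta _ m])
    show "\<not> eqv (Idm 0) (Zer 0 0)"
      using assms(5) zero_quotient_iff by (simp add: CB_def J_def)
  qed
  moreover have "CB p \<O> = CB m \<O>"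
  proof -
    interpret m: left_ideal "cyclotomic_ideal m \<O>"
      by (rule left_ideal_cyclotomic)
    have "m.eqv (dot_poly m) (Zer 1 1)"
      by (rule m.mem_J_iff[THEN iffD1])
        (simp_all add: dot_poly_mem_cyclotomic[simplified] typed_iff)
    moreover have "m dvd p"
      using m(2) p by blast
    ultimately have "m.eqv (dot_poly p) (Zer 1 1)"
      using m.dot_poly_mult_eqv_zero by (metis dvd_div_mult_self)
    then have "cyclotomic_ideal p \<O> a b \<subseteq> cyclotomic_ideal m \<O> a b" for a b
      by (intro cyclotomic_ideal_mono m.mem_J_iff[THEN iffD2]) (simp_all add: typed_iff)
    moreover have "cyclotomic_ideal m \<O> a b \<subseteq> cyclotomic_ideal p \<O> a b" for a b
      unfolding J_def[symmetric]
      by (intro cyclotomic_ideal_mono[of m p \<O>, folded J_def] mem_J_iff[THEN iffD2] m(2)[THEN iffD2])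
        (simp_all add: typed_iff)
    ultimately have "cyclotomic_ideal p \<O> = cyclotomic_ideal m \<O>"
      by (intro ext equalityI)
    then show ?thesis by (simp add: CB_def)
  qed
  ultimately have "CB p \<O> = CB_poly (m_L p \<O>)"
    by (simp add: CB_poly_def)
  then show ?thesis
    unfolding isomorphic_module_categories_def by (auto intro: module_category_iso_refl)
qed

end
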